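(* Let $M$ be a locally compact, locally connected metrizable space with a continuous flow, and let $K\subseteq M$ be an isolated attractor with only internal explosions. Then: (1) $\mathcal{A}(K)-K$ has finitely many connected components $C_1,\ldots,C_s$, and these can be arranged so that for some $r\le s$: (a) $\widehat{K}=\mathcal{H}(K)=K\cup(C_1\cup\ldots\cup C_r)$; (b) $\mathcal{A}(K)=\widehat{K}\cup(C_{r+1}\cup\ldots\cup C_s)$. (2) There exists a neighbourhood basis of $K$ comprised of isolating neighbourhoods $N$ such that $\partial N$ has finitely many connected components $n_1^{-},\ldots,n_r^{-}\subseteq N^{-}$ and $n_1^{+},\ldots,n_r^{+},\ldots,n_s^{+}\subseteq N^{+}$ which satisfy: (a) for every $j\le r$ both $n_j^{-}$ and $n_j^{+}$ are topological sections of $C_j$; (b) for every $r<j\le s$ the set $n_j^{+}$ is a topological section of $C_j$.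
   Context: A continuous flow is a continuous action $M\times\mathbb{R}\to M$, $(x,t)\mapsto x\cdot t$; $\omega(x)$ and $\alpha(x)$ are the usual limit sets, and $J^{+}(x)=\bigcap_{U,\,t\ge 0}\overline{U\cdot[t,+\infty)}$, where $U$ ranges over the open neighbourhoods of $x$ in $M$. A compact invariant set $K$ is isolated if it has a compact neighbourhood $N$ (an isolating neighbourhood) such that $K=\{x\in N: x\cdot\mathbb{R}\subseteq N\}$. For such $N$, $\partial N$ is its topological boundary in $M$, $N^{+}=\{x\in N:x\cdot[0,+\infty)\subseteq N\}$ and $N^{-}=\{x\in N:x\cdot(-\infty,0]\subseteq N\}$. An isolated attractor is an isolated compact invariant set $K$ such that $\mathcal{A}(K)=\{x\in M:\emptyset\ne\omega(x)\subseteq K\}$, its basin of attraction, is a neighbourhood of $K$ (stability is not required). $K$ has only internal explosions if $J^{+}(x)\subseteq K$ for all $x\in\mathcal{A}(K)-K$. $\widehat{K}=\bigcup_{x\in K}J^{+}(x)$ is the stabilization of $K$. $\mathcal{H}(K)$ is the set of homoclinic points, i.e. of $x\in\mathcal{A}(K)$ with $\emptyset\neq\alpha(x)\subseteq K$ and $\emptyset\ne\omega(x)\subseteq K$ (points of $K$ included). A topological section of an invariant set $C$ is a compact subset $\Sigma\subseteq C$ met by the trajectory of each point of $C$ in exactly one point and such that $\Sigma\times\mathbb{R}\to C$, $(x,t)\mapsto x\cdot t$, is a homeomorphism. *)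

theory Defs
  imports "HOL-Analysis.Analysis"
begin

text \<open>
  The phase space is a type of class \<^class>\<open>metric_space\<close>; the metric only provides metrizability
  of the topology, no definition below mentions it. A flow is a curried map \<open>\<phi>\<close>, with \<open>\<phi> x t\<close>
  standing for \<open>x \<cdot> t\<close>. A neighbourhood \<open>N\<close> of a set \<open>K\<close> need not be open: it is a set with
  \<open>K \<subseteq> interior N\<close>.
\<close>

definition continuous_flow :: "('a::topological_space \<Rightarrow> real \<Rightarrow> 'a) \<Rightarrow> bool" where
  "continuous_flow \<phi> \<longleftrightarrow>
     continuous_on UNIV (\<lambda>(x, t). \<phi> x t) \<and>
     (\<forall>x. \<phi> x 0 = x) \<and>
     (\<forall>x s t. \<phi> x (s + t) = \<phi> (\<phi> x s) t)"

definition flow_invariant :: "('a \<Rightarrow> real \<Rightarrow> 'a) \<Rightarrow> 'a set \<Rightarrow> bool" where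
  "flow_invariant \<phi> K \<longleftrightarrow> (\<forall>x\<in>K. range (\<phi> x) \<subseteq> K)"

definition omega_limit :: "('a::topological_space \<Rightarrow> real \<Rightarrow> 'a) \<Rightarrow> 'a \<Rightarrow> 'a set" where
  "omega_limit \<phi> x = (\<Inter>t\<in>{0..}. closure (\<phi> x ` {t..}))"

definition alpha_limit :: "('a::topological_space \<Rightarrow> real \<Rightarrow> 'a) \<Rightarrow> 'a \<Rightarrow> 'a set" where
  "alpha_limit \<phi> x = (\<Inter>t\<in>{..0}. closure (\<phi> x ` {..t}))"

definition prolongational_limit :: "('a::topological_space \<Rightarrow> real \<Rightarrow> 'a) \<Rightarrow> 'a \<Rightarrow> 'a set" where
  "prolongational_limit \<phi> x =
     (\<Inter>U\<in>{U. open U \<and> x \<in> U}. \<Inter>t\<in>{0..}. closure (\<Union>y\<in>U. \<phi> y ` {t..}))"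

definition isolating_neighbourhood ::
    "('a::topological_space \<Rightarrow> real \<Rightarrow> 'a) \<Rightarrow> 'a set \<Rightarrow> 'a set \<Rightarrow> bool" where
  "isolating_neighbourhood \<phi> K N \<longleftrightarrow>
     compact N \<and> K \<subseteq> interior N \<and> K = {x \<in> N. range (\<phi> x) \<subseteq> N}"

definition isolated_invariant_set ::
    "('a::topological_space \<Rightarrow> real \<Rightarrow> 'a) \<Rightarrow> 'a set \<Rightarrow> bool" where
  "isolated_invariant_set \<phi> K \<longleftrightarrow>
     compact K \<and> flow_invariant \<phi> K \<and> (\<exists>N. isolating_neighbourhood \<phi> K N)"

definition positive_part :: "('a \<Rightarrow> real \<Rightarrow> 'a) \<Rightarrow> 'a set \<Rightarrow> 'a set" where
  "positive_part \<phi> N = {x \<in> N. \<phi> x ` {0..} \<subseteq> N}"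

definition negative_part :: "('a \<Rightarrow> real \<Rightarrow> 'a) \<Rightarrow> 'a set \<Rightarrow> 'a set" where
  "negative_part \<phi> N = {x \<in> N. \<phi> x ` {..0} \<subseteq> N}"

definition basin :: "('a::topological_space \<Rightarrow> real \<Rightarrow> 'a) \<Rightarrow> 'a set \<Rightarrow> 'a set" where
  "basin \<phi> K = {x. omega_limit \<phi> x \<noteq> {} \<and> omega_limit \<phi> x \<subseteq> K}"

definition isolated_attractor ::
    "('a::topological_space \<Rightarrow> real \<Rightarrow> 'a) \<Rightarrow> 'a set \<Rightarrow> bool" where
  "isolated_attractor \<phi> K \<longleftrightarrow>
     isolated_invariant_set \<phi> K \<and> K \<subseteq> interior (basin \<phi> K)"

definition only_internal_explosions ::
    "('a::topological_space \<Rightarrow> real \<Rightarrow> 'a) \<Rightarrow> 'a set \<Rightarrow> bool" where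
  "only_internal_explosions \<phi> K \<longleftrightarrow>
     (\<forall>x\<in>basin \<phi> K - K. prolongational_limit \<phi> x \<subseteq> K)"

definition stabilization :: "('a::topological_space \<Rightarrow> real \<Rightarrow> 'a) \<Rightarrow> 'a set \<Rightarrow> 'a set" where
  "stabilization \<phi> K = (\<Union>x\<in>K. prolongational_limit \<phi> x)"

definition homoclinic_points :: "('a::topological_space \<Rightarrow> real \<Rightarrow> 'a) \<Rightarrow> 'a set \<Rightarrow> 'a set" where
  "homoclinic_points \<phi> K =
     {x \<in> basin \<phi> K. alpha_limit \<phi> x \<noteq> {} \<and> alpha_limit \<phi> x \<subseteq> K \<and>
                     omega_limit \<phi> x \<noteq> {} \<and> omega_limit \<phi> x \<subseteq> K}"

definition topological_section ::
    "('a::topological_space \<Rightarrow> real \<Rightarrow> 'a) \<Rightarrow> 'a set \<Rightarrow> 'a set \<Rightarrow> bool" where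
  "topological_section \<phi> C \<Sigma> \<longleftrightarrow>
     flow_invariant \<phi> C \<and> compact \<Sigma> \<and> \<Sigma> \<subseteq> C \<and>
     (\<forall>x\<in>C. \<exists>!y. y \<in> range (\<phi> x) \<inter> \<Sigma>) \<and>
     (\<exists>g. homeomorphism (\<Sigma> \<times> UNIV) C (\<lambda>(x, t). \<phi> x t) g)"

definition neighbourhood_basis :: "'a::topological_space set \<Rightarrow> 'a set set \<Rightarrow> bool" where
  "neighbourhood_basis K \<N> \<longleftrightarrow>
     (\<forall>N\<in>\<N>. K \<subseteq> interior N) \<and>
     (\<forall>U. K \<subseteq> interior U \<longrightarrow> (\<exists>N\<in>\<N>. N \<subseteq> U))"

end

theory Submission
  imports Defs
begin

text \<open>
  Having only internal explosions means that the flow on \<open>A - K\<close>, where \<open>A\<close> is the basin, is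
  dispersive: for compact \<open>P, Q \<subseteq> A - K\<close> no orbit goes from \<open>P\<close> to \<open>Q\<close> after a long time. Applied to
  the frontier of a compact neighbourhood \<open>N\<close> of \<open>K\<close>, this shows that orbits enter \<open>N\<close> uniformly
  on compact sets, that the homoclinic points outside \<open>K\<close> are open and closed in \<open>A - K\<close>, and that
  they are exactly the points of \<open>J\<^sup>+(x) - K\<close> for \<open>x \<in> K\<close>. Every component of \<open>A - K\<close> is open,
  invariant and meets the compact set \<open>\<partial>N\<close>, so there are finitely many.

  A bump function \<open>h\<close> with compact support in \<open>A - K\<close> whose positivity set meets every orbit has,
  along each orbit, compact support in time. Minus the barycentre of \<open>t \<mapsto> h(x \<cdot> t)\<close> is therefore a
  continuous function \<open>\<tau>\<close> on \<open>A - K\<close> with \<open>\<tau>(x \<cdot> t) = \<tau>(x) + t\<close> and compact level sets: each level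
  set is a section, connected in each component because it is a retract of that component. The
  neighbourhoods sought are \<open>K \<union> {\<tau> \<ge> T} \<union> {\<tau> \<le> -T, homoclinic}\<close> for large \<open>T\<close>.
\<close>

section \<open>Topological preliminaries\<close>

lemma locally_compact_neighbourhood:
  fixes P U :: "'a::metric_space set"
  assumes "locally compact (UNIV :: 'a set)" and "compact P" "open U" "P \<subseteq> U"
  obtains V where "compact V" "P \<subseteq> interior V" "V \<subseteq> U"
proof -
  have "\<exists>W V. open W \<and> x \<in> W \<and> W \<subseteq> V \<and> compact V \<and> V \<subseteq> U" if "x \<in> P" for x
  proof -
    have "openin (top_of_set UNIV) U" "x \<in> U" using assms that by auto
    then obtain W V where "openin (top_of_set UNIV) W" "compact V" "x \<in> W" "W \<subseteq> V" "V \<subseteq> U"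
      using assms(1) unfolding locally_def by metis
    then show ?thesis by auto
  qed
  then obtain W V where WV: "\<And>x. x \<in> P \<Longrightarrow> open (W x) \<and> x \<in> W x \<and> W x \<subseteq> V x \<and> compact (V x) \<and> V x \<subseteq> U"
    by metis
  obtain P' where P': "P' \<subseteq> P" "finite P'" "P \<subseteq> (\<Union>x\<in>P'. W x)"
    using compactE_image[OF \<open>compact P\<close>, of P W] WV by blast
  show ?thesis
  proof
    show "compact (\<Union>x\<in>P'. V x)" using P' WV by blast
    have "(\<Union>x\<in>P'. W x) \<subseteq> interior (\<Union>x\<in>P'. V x)"
      using P' WV by (intro interior_maximal) blast+
    then show "P \<subseteq> interior (\<Union>x\<in>P'. V x)" using P' by blast
    show "(\<Union>x\<in>P'. V x) \<subseteq> U" using P' WV by blast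
  qed
qed

text \<open>Leaving \<open>interior N\<close> would force a connected set through the frontier.
  Applied below to half-orbits: avoiding \<open>frontier N\<close> and entering
  \<open>interior N\<close> once means staying there.\<close>

lemma connected_subset_interior:
  assumes "connected S" "S \<inter> interior N \<noteq> {}" "S \<inter> frontier N = {}"
  shows "S \<subseteq> interior N"
proof -
  have "S - N = {}"
    using assms connected_Int_frontier[of S N] interior_subset by blast
  then show ?thesis
    using assms(3) closure_subset[of N] unfolding frontier_def by blast
qed

lemma component_of_clopen:
  assumes "connected C" "C \<noteq> {}" "openin (top_of_set S) C" "closedin (top_of_set S) C"
  shows "C \<in> components S"
proof -
  have "C \<subseteq> S" using assms(3) openin_imp_subset by blast
  moreover have "D = C" if D: "C \<subseteq> D" "D \<subseteq> S" "connected D" for D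
  proof -
    have "openin (top_of_set D) C" "closedin (top_of_set D) C"
      using assms D openin_subset_trans closedin_subset_trans by blast+
    then show ?thesis using assms(2) D(3) connected_clopen by metis
  qed
  ultimately show ?thesis using assms unfolding in_components_maximal by blast
qed

text \<open>Each member is a component because a connected set has no proper nonempty clopen part;
  the members cover \<open>S\<close>, so any further component would overlap one of them.\<close>

lemma components_eqI:
  assumes "\<And>C. C \<in> \<F> \<Longrightarrow> connected C \<and> C \<noteq> {} \<and> openin (top_of_set S) C \<and> closedin (top_of_set S) C"
    and "\<Union>\<F> = S"
  shows "components S = \<F>"
proof (rule antisym)
  have sub: "\<F> \<subseteq> components S" using component_of_clopen assms by blast
  show "components S \<subseteq> \<F>"
  proof
    fix D assume D: "D \<in> components S"
    then obtain x where "x \<in> D" "x \<in> S"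
      using in_components_nonempty in_components_subset by blast
    then obtain C where "C \<in> \<F>" "x \<in> C" using assms(2) by blast
    then show "D \<in> \<F>"
      using sub components_nonoverlap[OF D, of C] \<open>x \<in> D\<close> by blast
  qed
  show "\<F> \<subseteq> components S" by (rule sub)
qed

section \<open>Flows and their limit sets\<close>

locale flow =
  fixes \<phi> :: "'a::metric_space \<Rightarrow> real \<Rightarrow> 'a"
  assumes flow: "continuous_flow \<phi>"
begin

lemma flow_0 [simp]: "\<phi> x 0 = x"
  using flow unfolding continuous_flow_def by blast

lemma flow_flow [simp]: "\<phi> (\<phi> x s) t = \<phi> x (s + t)"
  using flow unfolding continuous_flow_def by metis

lemma continuous_on_flow:
  assumes "continuous_on S f" "continuous_on S g"
  shows "continuous_on S (\<lambda>x. \<phi> (f x) (g x))"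
proof -
  have "continuous_on UNIV (\<lambda>(x, t). \<phi> x t)"
    using flow unfolding continuous_flow_def by blast
  then have "continuous_on S (\<lambda>x. (\<lambda>(x, t). \<phi> x t) (f x, g x))"
    by (rule continuous_on_compose2) (use assms in \<open>auto intro!: continuous_intros\<close>)
  then show ?thesis by simp
qed

lemma connected_orbit_segment: "connected I \<Longrightarrow> connected (\<phi> x ` I)"
  by (intro connected_continuous_image continuous_on_flow continuous_on_const continuous_on_id)

lemma compact_flow_image:
  assumes "compact P" "compact I"
  shows "compact ((\<lambda>(x, t). \<phi> x t) ` (P \<times> I))"
  unfolding case_prod_beta
  by (intro compact_continuous_image continuous_on_flow continuous_on_fst continuous_on_snd
      continuous_on_id compact_Times assms)

lemma open_flow_preimage: "open U \<Longrightarrow> open {x. \<phi> x t \<in> U}"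
  using open_vimage[of U "\<lambda>x. \<phi> x t"] continuous_on_flow[of UNIV "\<lambda>x. x" "\<lambda>_. t"]
  by (simp add: vimage_def)

text \<open>Two nested compactness arguments, as in the tube lemma: \<open>Q\<close> is covered for
  a fixed point of \<open>P\<close>, then \<open>P\<close> itself. Pointwise information about J+
  becomes one common time for a whole neighbourhood of \<open>P\<close>.\<close>

lemma prolongational_limit_separation:
  assumes "compact P" "compact Q" and PQ: "\<And>x. x \<in> P \<Longrightarrow> prolongational_limit \<phi> x \<inter> Q = {}"
  obtains U T where "open U" "P \<subseteq> U" "T > 0" "\<And>x t. x \<in> U \<Longrightarrow> t \<ge> T \<Longrightarrow> \<phi> x t \<notin> Q"
proof -
  \<comment> \<open>\<open>good\<close> survives shrinking \<open>U\<close> or \<open>B\<close> and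
    enlarging \<open>T\<close>, which permits the finite intersections and maxima below.\<close>
  define good where "good U T B \<longleftrightarrow> (\<forall>x\<in>U. \<forall>t\<ge>T. \<phi> x t \<notin> B)" for U B and T :: real
  have point: "\<exists>U T. open U \<and> x \<in> U \<and> good U T Q" if "x \<in> P" for x
  proof -
    have "\<exists>U T V. open U \<and> x \<in> U \<and> open V \<and> y \<in> V \<and> good U T V" if "y \<in> Q" for y
    proof -
      have "y \<notin> prolongational_limit \<phi> x" using that \<open>x \<in> P\<close> PQ by blast
      then obtain U t where U: "open U" "x \<in> U" and y: "y \<notin> closure (\<Union>y\<in>U. \<phi> y ` {t..})"
        unfolding prolongational_limit_def by auto
      have "good U t (- closure (\<Union>y\<in>U. \<phi> y ` {t..}))"
        unfolding good_def using closure_subset[of "\<Union>y\<in>U. \<phi> y ` {t..}"] by fastforce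
      then show ?thesis using U y open_Compl[OF closed_closure] by blast
    qed
    then obtain U T V where UTV: "\<And>y. y \<in> Q \<Longrightarrow>
        open (U y) \<and> x \<in> U y \<and> open (V y) \<and> y \<in> V y \<and> good (U y) (T y) (V y)"
      by metis
    obtain Q' where Q': "Q' \<subseteq> Q" "finite Q'" "Q \<subseteq> (\<Union>y\<in>Q'. V y)"
      using compactE_image[OF \<open>compact Q\<close>, of Q V] UTV by blast
    \<comment> \<open>The inserted \<open>0\<close> keeps \<open>Max\<close> defined when the finite
      subcover is empty.\<close>
    define T0 where "T0 = Max (insert 0 (T ` Q'))"
    have T0: "T y \<le> T0" if "y \<in> Q'" for y
      unfolding T0_def using that Q' by (intro Max_ge) auto
    have "good (\<Inter>y\<in>Q'. U y) T0 Q"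
      unfolding good_def
    proof (intro ballI allI impI notI)
      fix z t assume z: "z \<in> (\<Inter>y\<in>Q'. U y)" "T0 \<le> t" "\<phi> z t \<in> Q"
      then obtain y where y: "y \<in> Q'" "\<phi> z t \<in> V y" using Q' by blast
      have "good (U y) (T y) (V y)" using UTV y Q' by blast
      then show False using y z T0[of y] unfolding good_def by fastforce
    qed
    moreover have "open (\<Inter>y\<in>Q'. U y)" "x \<in> (\<Inter>y\<in>Q'. U y)" using UTV Q' by blast+
    ultimately show ?thesis by blast
  qed
  then obtain U T where UT: "\<And>x. x \<in> P \<Longrightarrow> open (U x) \<and> x \<in> U x \<and> good (U x) (T x) Q"
    by metis
  obtain P' where P': "P' \<subseteq> P" "finite P'" "P \<subseteq> (\<Union>x\<in>P'. U x)"
    using compactE_image[OF \<open>compact P\<close>, of P U] UT by blast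
  define T0 where "T0 = Max (insert 0 (T ` P'))"
  have T0: "T x \<le> T0" if "x \<in> P'" for x
    unfolding T0_def using that P' by (intro Max_ge) auto
  show ?thesis
  proof
    show "open (\<Union>x\<in>P'. U x)" using UT P' by blast
    show "P \<subseteq> (\<Union>x\<in>P'. U x)" by (rule P')
    show "max T0 1 > 0" by simp
    show "\<phi> x t \<notin> Q" if x: "x \<in> (\<Union>x\<in>P'. U x)" and t: "t \<ge> max T0 1" for x t
    proof -
      obtain z where z: "z \<in> P'" "x \<in> U z" using x by blast
      have "good (U z) (T z) Q" using UT z P' by blast
      then show ?thesis using z t T0[of z] unfolding good_def by fastforce
    qed
  qed
qed

text \<open>With \<open>s\<close> and \<open>r\<close> both free, one statement yields invariance of
  the limit set (\<open>r = 0\<close>) and its independence of the base point on the orbit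
  (\<open>s = 0\<close>).\<close>

lemma flow_mem_omega_limit:
  assumes "y \<in> omega_limit \<phi> x" shows "\<phi> y s \<in> omega_limit \<phi> (\<phi> x r)"
  unfolding omega_limit_def
proof (intro INT_I)
  fix t :: real assume "t \<in> {0..}"
  \<comment> \<open>Chosen so that \<open>u \<ge> t'\<close> gives \<open>u + s - r \<ge> t\<close>:
    the tail, pushed by \<open>s\<close>, lands in the wanted tail of the shifted orbit.\<close>
  define t' where "t' = max 0 (t + r - s)"
  have "y \<in> closure (\<phi> x ` {t'..})"
    using assms unfolding omega_limit_def t'_def by simp
  then have "\<phi> y s \<in> (\<lambda>z. \<phi> z s) ` closure (\<phi> x ` {t'..})" by blast
  also have "\<dots> \<subseteq> closure (\<phi> (\<phi> x r) ` {t..})"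
  proof (rule image_closure_subset)
    show "(\<lambda>z. \<phi> z s) ` (\<phi> x ` {t'..}) \<subseteq> closure (\<phi> (\<phi> x r) ` {t..})"
    proof (intro subsetI, elim imageE)
      fix w z u assume w: "w = \<phi> z s" "z = \<phi> x u" and "u \<in> {t'..}"
      then have "\<phi> (\<phi> x u) s = \<phi> (\<phi> x r) (u + s - r)" "u + s - r \<ge> t"
        unfolding t'_def by auto
      then have "w \<in> \<phi> (\<phi> x r) ` {t..}" unfolding w by (intro image_eqI) auto
      then show "w \<in> closure (\<phi> (\<phi> x r) ` {t..})"
        by (rule subsetD[OF closure_subset])
    qed
  qed (intro continuous_on_flow continuous_on_const continuous_on_id closed_closure)+
  finally show "\<phi> y s \<in> closure (\<phi> (\<phi> x r) ` {t..})" .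
qed

lemma omega_limit_flow [simp]: "omega_limit \<phi> (\<phi> x r) = omega_limit \<phi> x"
  using flow_mem_omega_limit[of _ x 0 r] flow_mem_omega_limit[of _ "\<phi> x r" 0 "-r"] by auto

text \<open>Together with \<open>flow_reverse\<close> this carries facts on omega-limits over to
  alpha-limits by reversing time.\<close>

lemma alpha_limit_eq_omega_limit: "alpha_limit \<phi> x = omega_limit (\<lambda>x t. \<phi> x (- t)) x"
proof -
  have "(\<lambda>t. \<phi> x (- t)) ` {t..} = \<phi> x ` {..- t}" for t
    by (simp add: image_image[symmetric, of "\<phi> x" uminus])
  then have *: "closure ((\<lambda>t. \<phi> x (- t)) ` {t..}) = closure (\<phi> x ` {..- t})" for t by simp
  have "{..0::real} = uminus ` {0..}" by simp
  then show ?thesis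
    unfolding alpha_limit_def omega_limit_def * by (simp only: image_image)
qed

lemma flow_reverse: "flow (\<lambda>x t. \<phi> x (- t))"
proof
  have "continuous_on UNIV (\<lambda>z. \<phi> (fst z) (- snd z))"
    by (intro continuous_on_flow continuous_intros)
  then show "continuous_flow (\<lambda>x t. \<phi> x (- t))"
    unfolding continuous_flow_def by (simp add: case_prod_beta)
qed

text \<open>The closures of tails are nested and all meet the compact set \<open>N\<close>, so the
  finite intersection property applies.\<close>

lemma omega_limit_nonempty:
  assumes "compact N" "\<And>t. t \<ge> t0 \<Longrightarrow> \<phi> x t \<in> N"
  shows "omega_limit \<phi> x \<noteq> {}" "omega_limit \<phi> x \<subseteq> N"
proof -
  have "N \<inter> (\<Inter>t\<in>{0..}. closure (\<phi> x ` {t..})) \<noteq> {}"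
  proof (rule compact_imp_fip_image[OF assms(1)])
    fix I' :: "real set" assume I': "finite I'" "I' \<subseteq> {0..}"
    define b where "b = Max (insert 0 I')"
    have b: "i \<le> b" if "i \<in> I'" for i
      unfolding b_def using that I' by (intro Max_ge) auto
    have "\<phi> x (max b t0) \<in> N" using assms(2) by simp
    moreover have "\<phi> x (max b t0) \<in> closure (\<phi> x ` {i..})" if "i \<in> I'" for i
      using b[OF that] by (intro subsetD[OF closure_subset] imageI) auto
    ultimately show "N \<inter> (\<Inter>i\<in>I'. closure (\<phi> x ` {i..})) \<noteq> {}" by blast
  qed simp
  then show "omega_limit \<phi> x \<noteq> {}" unfolding omega_limit_def by blast
  have "closure (\<phi> x ` {max 0 t0..}) \<subseteq> N"
    using assms by (intro closure_minimal) (auto intro: compact_imp_closed)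
  moreover have "omega_limit \<phi> x \<subseteq> closure (\<phi> x ` {max 0 t0..})"
    unfolding omega_limit_def by force
  ultimately show "omega_limit \<phi> x \<subseteq> N" by blast
qed

lemma omega_limit_visits:
  assumes "open U" "omega_limit \<phi> x \<inter> U \<noteq> {}"
  obtains u where "u \<ge> t" "\<phi> x u \<in> U"
proof -
  have "omega_limit \<phi> x \<subseteq> closure (\<phi> x ` {max 0 t..})"
    unfolding omega_limit_def by force
  then have "U \<inter> closure (\<phi> x ` {max 0 t..}) \<noteq> {}" using assms(2) by blast
  then have "U \<inter> \<phi> x ` {max 0 t..} \<noteq> {}"
    using open_Int_closure_eq_empty[OF assms(1)] by metis
  then show ?thesis using that by auto
qed

lemma alpha_limit_nonempty:
  assumes "compact N" "\<And>t. t \<le> t0 \<Longrightarrow> \<phi> x t \<in> N"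
  shows "alpha_limit \<phi> x \<noteq> {}" "alpha_limit \<phi> x \<subseteq> N"
  using flow.omega_limit_nonempty[OF flow_reverse assms(1), of "- t0" x] assms(2)
  by (simp_all add: alpha_limit_eq_omega_limit)

lemma alpha_limit_visits:
  assumes "open U" "alpha_limit \<phi> x \<inter> U \<noteq> {}"
  obtains u where "u \<le> t" "\<phi> x u \<in> U"
proof -
  obtain u where "u \<ge> - t" "\<phi> x (- u) \<in> U"
    using flow.omega_limit_visits[OF flow_reverse assms[unfolded alpha_limit_eq_omega_limit], of "- t"] .
  then show ?thesis using that[of "- u"] by simp
qed

lemma flow_mem_alpha_limit:
  assumes "y \<in> alpha_limit \<phi> x" shows "\<phi> y s \<in> alpha_limit \<phi> (\<phi> x r)"
  using flow.flow_mem_omega_limit[OF flow_reverse assms[unfolded alpha_limit_eq_omega_limit], of "- s" "- r"]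
  by (simp add: alpha_limit_eq_omega_limit)

lemma alpha_limit_flow [simp]: "alpha_limit \<phi> (\<phi> x r) = alpha_limit \<phi> x"
  using flow_mem_alpha_limit[of _ x 0 r] flow_mem_alpha_limit[of _ "\<phi> x r" 0 "-r"] by auto

lemma flow_mem_prolongational_limit:
  assumes "y \<in> prolongational_limit \<phi> x" shows "\<phi> y s \<in> prolongational_limit \<phi> x"
  unfolding prolongational_limit_def
proof (intro INT_I)
  fix U t assume U: "U \<in> {U. open U \<and> x \<in> U}" and "t \<in> {0::real..}"
  define t' where "t' = max 0 (t - s)"
  have "y \<in> closure (\<Union>z\<in>U. \<phi> z ` {t'..})"
    using assms U unfolding prolongational_limit_def t'_def by simp
  then have "\<phi> y s \<in> (\<lambda>z. \<phi> z s) ` closure (\<Union>z\<in>U. \<phi> z ` {t'..})" by blast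
  also have "\<dots> \<subseteq> closure (\<Union>z\<in>U. \<phi> z ` {t..})"
  proof (rule image_closure_subset)
    show "(\<lambda>z. \<phi> z s) ` (\<Union>z\<in>U. \<phi> z ` {t'..}) \<subseteq> closure (\<Union>z\<in>U. \<phi> z ` {t..})"
    proof (intro subsetI, elim imageE UN_E)
      fix w v z u assume w: "w = \<phi> v s" "v = \<phi> z u" and z: "z \<in> U" "u \<in> {t'..}"
      then have "w \<in> \<phi> z ` {t..}" unfolding t'_def by auto
      then show "w \<in> closure (\<Union>z\<in>U. \<phi> z ` {t..})"
        using z(1) by (intro subsetD[OF closure_subset] UN_I)
    qed
  qed (intro continuous_on_flow continuous_on_const continuous_on_id closed_closure)+
  finally show "\<phi> y s \<in> closure (\<Union>z\<in>U. \<phi> z ` {t..})" .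
qed

text \<open>The orbit of \<open>y\<close> visits every neighbourhood of \<open>x\<close> at
  arbitrarily remote past times, and from such a visit the flow takes arbitrarily long to reach
  \<open>y\<close>.\<close>

lemma mem_prolongational_limit_alpha:
  assumes "x \<in> alpha_limit \<phi> y" shows "y \<in> prolongational_limit \<phi> x"
  unfolding prolongational_limit_def
proof (intro INT_I)
  fix U t assume U: "U \<in> {U. open U \<and> x \<in> U}" and "t \<in> {0::real..}"
  then obtain u where "u \<le> - t" "\<phi> y u \<in> U"
    using alpha_limit_visits[of U y "- t"] assms by auto
  moreover then have "y \<in> \<phi> (\<phi> y u) ` {t..}" by (intro image_eqI[of _ _ "- u"]) auto
  ultimately show "y \<in> closure (\<Union>z\<in>U. \<phi> z ` {t..})"
    by (intro subsetD[OF closure_subset] UN_I)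
qed

end

section \<open>Barycentres of bump functions on the line\<close>

lemma has_integral_UNIV_of_support:
  fixes f :: "real \<Rightarrow> real"
  assumes "continuous_on UNIV f" "\<And>t. \<bar>t\<bar> \<ge> R \<Longrightarrow> f t = 0"
  shows "(f has_integral integral {-R..R} f) UNIV"
proof (rule has_integral_on_superset)
  show "(f has_integral integral {-R..R} f) {-R..R}"
    using assms(1) continuous_on_subset
    by (intro integrable_integral integrable_continuous_interval) blast
  show "f t = 0" if "t \<notin> {-R..R}" for t
    using that by (intro assms(2)) auto
qed simp

lemma integral_UNIV_pos:
  fixes f :: "real \<Rightarrow> real"
  assumes cont: "continuous_on UNIV f" and supp: "\<And>t. \<bar>t\<bar> \<ge> R \<Longrightarrow> f t = 0"
    and "\<And>t. f t \<ge> 0" "f t0 \<noteq> 0"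
  shows "integral UNIV f > 0"
proof -
  \<comment> \<open>Enlarged so that \<open>{-S..S}\<close> is nondegenerate and contains
    \<open>t0\<close>; a continuous nonnegative function with zero integral there would vanish at
    \<open>t0\<close>.\<close>
  define S where "S = max R (\<bar>t0\<bar> + 1)"
  have "continuous_on {-S..S} f" using cont continuous_on_subset by blast
  moreover have "- S < S" "t0 \<in> {-S..S}" unfolding S_def by auto
  ultimately have "integral {-S..S} f \<noteq> 0" "integral {-S..S} f \<ge> 0"
    using integral_eq_0_iff[of "-S" S f] assms(3,4)
    by (auto intro!: integral_nonneg integrable_continuous_interval)
  moreover have "integral UNIV f = integral {-S..S} f"
    using supp by (intro integral_unique has_integral_UNIV_of_support cont) (auto simp: S_def)
  ultimately show ?thesis by linarith
qed

definition barycentre :: "(real \<Rightarrow> real) \<Rightarrow> real" where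
  "barycentre f = integral UNIV (\<lambda>t. t * f t) / integral UNIV f"

text \<open>Substituting \<open>t - s\<close> for \<open>t\<close> turns the numerator into the
  first moment minus \<open>s\<close> times the mass. This makes \<tau> additive along
  orbits.\<close>

lemma barycentre_shift:
  assumes cont: "continuous_on UNIV f" and supp: "\<And>t. \<bar>t\<bar> \<ge> R \<Longrightarrow> f t = 0"
    and "integral UNIV f \<noteq> 0"
  shows "barycentre (\<lambda>t. f (t + s)) = barycentre f - s"
proof -
  have shift: "integral UNIV (\<lambda>t. g (t + s)) = integral UNIV g"
    if g: "continuous_on UNIV g" "\<And>t. \<bar>t\<bar> \<ge> R \<Longrightarrow> g t = 0" for g :: "real \<Rightarrow> real"
  proof -
    have "(g has_integral integral {-R..R} g) {-R..R}"
      using g(1) continuous_on_subset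
      by (intro integrable_integral integrable_continuous_interval) blast
    then have "((\<lambda>t. g (t + s)) has_integral integral {-R..R} g) {-R-s..R-s}"
      by (rule has_integral_shift_real_ivl)
    then have "((\<lambda>t. g (t + s)) has_integral integral {-R..R} g) UNIV"
      by (rule has_integral_on_superset) (auto intro!: g(2))
    then show ?thesis
      using has_integral_UNIV_of_support[OF g] by (metis integral_unique)
  qed
  \<comment> \<open>The function translated here is \<open>(t - s) * f t\<close>, whose shift by
    \<open>s\<close> is \<open>t * f (t + s)\<close>.\<close>
  have "integral UNIV (\<lambda>t. t * f (t + s)) = integral UNIV (\<lambda>t. t * f t - s * f t)"
    using shift[of "\<lambda>t. t * f t - s * f t"] cont supp
    by (simp add: continuous_intros algebra_simps)
  also have "\<dots> = integral UNIV (\<lambda>t. t * f t) - integral UNIV (\<lambda>t. s * f t)"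
  proof (rule integral_diff)
    have "((\<lambda>t. g t * f t) has_integral integral {-R..R} (\<lambda>t. g t * f t)) UNIV"
      if "continuous_on UNIV g" for g
      using cont supp that by (intro has_integral_UNIV_of_support continuous_intros) auto
    from this[of "\<lambda>t. t"] this[of "\<lambda>t. s"]
    show "(\<lambda>t. t * f t) integrable_on UNIV" "(\<lambda>t. s * f t) integrable_on UNIV"
      by (auto intro: has_integral_integrable)
  qed
  finally show ?thesis
    unfolding barycentre_def using shift[OF cont supp] assms(3) by (simp add: field_simps)
qed

text \<open>Without mass on \<open>t \<le> 0\<close>, the integrand \<open>t * f t\<close> would be
  nonnegative and not identically zero, so the first moment would be positive; the other side is
  symmetric. Used to place a zero of \<tau> between two visits to a compact set.\<close>

lemma barycentre_eq_0:
  assumes cont: "continuous_on UNIV f" and supp: "\<And>t. \<bar>t\<bar> \<ge> R \<Longrightarrow> f t = 0"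
    and nonneg: "\<And>t. f t \<ge> 0" and "f t0 \<noteq> 0" and zero: "barycentre f = 0"
  obtains t1 t2 where "t1 \<le> 0" "0 \<le> t2" "f t1 \<noteq> 0" "f t2 \<noteq> 0"
proof -
  have "integral UNIV f > 0"
    using supp by (intro integral_UNIV_pos[OF cont _ nonneg \<open>f t0 \<noteq> 0\<close>, of R])
  then have int0: "integral UNIV (\<lambda>t. t * f t) = 0"
    using zero unfolding barycentre_def by simp
  have conts: "continuous_on UNIV (\<lambda>t. t * f t)" "continuous_on UNIV (\<lambda>t. - (t * f t))"
    using cont by (auto intro!: continuous_intros)
  have "\<exists>t\<le>0. f t \<noteq> 0"
  proof (rule ccontr)
    assume neg: "\<not> ?thesis"
    then have "0 \<le> t * f t" for t using nonneg[of t] by (cases "t \<le> 0") auto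
    moreover have "t0 * f t0 \<noteq> 0" using neg \<open>f t0 \<noteq> 0\<close> by auto
    ultimately have "integral UNIV (\<lambda>t. t * f t) > 0"
      using supp by (intro integral_UNIV_pos[OF conts(1), of R]) auto
    then show False using int0 by simp
  qed
  moreover have "\<exists>t\<ge>0. f t \<noteq> 0"
  proof (rule ccontr)
    assume neg: "\<not> ?thesis"
    then have "0 \<le> - (t * f t)" for t
      using nonneg[of t] by (cases "t \<ge> 0") (auto simp: mult_nonpos_nonneg)
    moreover have "- (t0 * f t0) \<noteq> 0" using neg \<open>f t0 \<noteq> 0\<close> by auto
    ultimately have "integral UNIV (\<lambda>t. - (t * f t)) > 0"
      using supp by (intro integral_UNIV_pos[OF conts(2), of R]) auto
    then show False using int0 by simp
  qed
  ultimately show ?thesis using that by blast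
qed

section \<open>Attractors with only internal explosions\<close>

lemma isolating_neighbourhoodD:
  assumes "isolating_neighbourhood \<phi> K N"
  shows "compact N" "K \<subseteq> interior N" "x \<in> N \<Longrightarrow> range (\<phi> x) \<subseteq> N \<Longrightarrow> x \<in> K"
proof -
  have *: "compact N \<and> K \<subseteq> interior N \<and> K = {x \<in> N. range (\<phi> x) \<subseteq> N}"
    using assms unfolding isolating_neighbourhood_def .
  show "compact N" by (rule conjunct1[OF *])
  show "K \<subseteq> interior N" by (rule conjunct1[OF conjunct2[OF *]])
  have "K = {x \<in> N. range (\<phi> x) \<subseteq> N}" by (rule conjunct2[OF conjunct2[OF *]])
  then show "x \<in> K" if "x \<in> N" "range (\<phi> x) \<subseteq> N"
    using that by (subst \<open>K = _\<close>) simp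
qed

locale attractor = flow \<phi> for \<phi> :: "'a::metric_space \<Rightarrow> real \<Rightarrow> 'a" +
  fixes K :: "'a set"
  assumes loc_compact: "locally compact (UNIV :: 'a set)"
    and attractor: "isolated_attractor \<phi> K"
    and internal: "only_internal_explosions \<phi> K"
begin

section \<open>The basin and dispersiveness outside \<open>K\<close>\<close>

abbreviation "A \<equiv> basin \<phi> K"
abbreviation "H \<equiv> homoclinic_points \<phi> K"

lemma compact_K: "compact K" and K_sub_int_A: "K \<subseteq> interior A"
  using attractor unfolding isolated_attractor_def isolated_invariant_set_def by auto

lemma flow_mem_K [simp]: "\<phi> x t \<in> K \<longleftrightarrow> x \<in> K"
proof -
  have inv: "\<phi> y s \<in> K" if "y \<in> K" for y s
    using attractor that
    unfolding isolated_attractor_def isolated_invariant_set_def flow_invariant_def by blast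
  show ?thesis using inv[of x t] inv[of "\<phi> x t" "- t"] by auto
qed

lemma flow_mem_A [simp]: "\<phi> x t \<in> A \<longleftrightarrow> x \<in> A"
  unfolding basin_def by simp

lemma K_sub_A: "K \<subseteq> A"
  using K_sub_int_A interior_subset by blast

text \<open>The omega-limit set of a point of the basin lies in \<open>K\<close>, so the orbit
  enters \<open>interior A\<close> at some time \<open>u\<close>; the preimage under the
  time-\<open>u\<close> map is a neighbourhood inside the invariant set \<open>A\<close>.\<close>

lemma open_A: "open A"
proof (subst open_subopen, intro ballI)
  fix x assume "x \<in> A"
  then have "omega_limit \<phi> x \<inter> interior A \<noteq> {}"
    using K_sub_int_A unfolding basin_def by auto
  then obtain u where u: "\<phi> x u \<in> interior A"
    using omega_limit_visits[OF open_interior] by metis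
  have "open {y. \<phi> y u \<in> interior A}" "{y. \<phi> y u \<in> interior A} \<subseteq> A"
    using open_flow_preimage[OF open_interior] interior_subset[of A] by auto
  then show "\<exists>T. open T \<and> x \<in> T \<and> T \<subseteq> A" using u by blast
qed

lemma open_A_diff_K: "open (A - K)"
  using open_A compact_K compact_imp_closed by blast

lemma omega_limit_meets:
  assumes "x \<in> A" "K \<subseteq> U" shows "omega_limit \<phi> x \<inter> U \<noteq> {}"
proof -
  have "omega_limit \<phi> x \<noteq> {}" "omega_limit \<phi> x \<subseteq> K" using assms(1) unfolding basin_def by auto
  then show ?thesis using assms(2) by blast
qed

lemma prolongational_limit_sub_K: "x \<in> A - K \<Longrightarrow> prolongational_limit \<phi> x \<subseteq> K"
  using internal unfolding only_internal_explosions_def by blast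

text \<open>J+ of a point of \<open>P\<close> lies in \<open>K\<close> and so misses
  \<open>Q\<close>; separation then bounds the forward times. Exchanging \<open>P\<close> and
  \<open>Q\<close> bounds the backward times.\<close>

lemma no_return:
  assumes P: "compact P" "P \<subseteq> A - K" and Q: "compact Q" "Q \<subseteq> A - K"
  obtains T where "T > 0" "\<And>x t. x \<in> P \<Longrightarrow> \<bar>t\<bar> \<ge> T \<Longrightarrow> \<phi> x t \<notin> Q"
proof -
  note J = prolongational_limit_sub_K
  obtain T1 where T1: "T1 > 0" "\<And>x t. x \<in> P \<Longrightarrow> t \<ge> T1 \<Longrightarrow> \<phi> x t \<notin> Q"
    using prolongational_limit_separation[OF P(1) Q(1)] J P(2) Q(2)
    by (smt (verit, best) DiffD2 disjoint_iff subsetD)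
  obtain T2 where T2: "T2 > 0" "\<And>x t. x \<in> Q \<Longrightarrow> t \<ge> T2 \<Longrightarrow> \<phi> x t \<notin> P"
    using prolongational_limit_separation[OF Q(1) P(1)] J P(2) Q(2)
    by (smt (verit, best) DiffD2 disjoint_iff subsetD)
  show ?thesis
  proof
    show "max T1 T2 > 0" using T1 by simp
    show "\<phi> x t \<notin> Q" if "x \<in> P" "\<bar>t\<bar> \<ge> max T1 T2" for x t
      using T1(2)[of x t] T2(2)[of "\<phi> x t" "- t"] that by (cases "t \<ge> 0") auto
  qed
qed

lemma isolating_neighbourhood_subset:
  assumes "isolating_neighbourhood \<phi> K N" "compact N'" "K \<subseteq> interior N'" "N' \<subseteq> N"
  shows "isolating_neighbourhood \<phi> K N'"
proof -
  have "K = {x \<in> N'. range (\<phi> x) \<subseteq> N'}"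
  proof
    show "K \<subseteq> {x \<in> N'. range (\<phi> x) \<subseteq> N'}" using assms(3) interior_subset[of N'] by force
    show "{x \<in> N'. range (\<phi> x) \<subseteq> N'} \<subseteq> K"
      using isolating_neighbourhoodD(3)[OF assms(1)] assms(4) by blast
  qed
  then show ?thesis using assms(2,3) unfolding isolating_neighbourhood_def by (intro conjI)
qed

lemma isolating_neighbourhood_within:
  assumes "open U" "K \<subseteq> U"
  obtains N where "compact N" "K \<subseteq> interior N" "N \<subseteq> U" "N \<subseteq> A" "isolating_neighbourhood \<phi> K N"
proof -
  obtain N0 where N0: "isolating_neighbourhood \<phi> K N0"
    using attractor unfolding isolated_attractor_def isolated_invariant_set_def by blast
  obtain N where N: "compact N" "K \<subseteq> interior N" "N \<subseteq> U \<inter> interior N0 \<inter> A"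
  proof (rule locally_compact_neighbourhood[OF loc_compact compact_K])
    show "open (U \<inter> interior N0 \<inter> A)" "K \<subseteq> U \<inter> interior N0 \<inter> A"
      using assms open_A isolating_neighbourhoodD(2)[OF N0] K_sub_A by auto
  qed
  moreover have "N \<subseteq> N0" using N(3) interior_subset[of N0] by blast
  ultimately show ?thesis using that isolating_neighbourhood_subset[OF N0 N(1,2)] by blast
qed

section \<open>Uniform entry into neighbourhoods of \<open>K\<close>\<close>

lemma frontier_neighbourhood:
  assumes "compact N" "K \<subseteq> interior N" "N \<subseteq> A"
  shows "compact (frontier N)" "frontier N \<subseteq> A - K"
proof -
  have N: "closed N" "frontier N \<subseteq> N"
    using compact_imp_closed[OF assms(1)] frontier_subset_closed by blast+
  then show "compact (frontier N)"
    using compact_Int_closed[OF assms(1) frontier_closed[of N]] by (simp add: inf_absorb2)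
  show "frontier N \<subseteq> A - K" using N assms unfolding frontier_def by blast
qed

text \<open>After the time given by \<open>no_return\<close>, orbits from \<open>Z\<close> no longer
  meet the frontier, and each must visit \<open>interior N\<close> because its omega-limit set lies
  in \<open>K\<close>; by connectedness it stays there.\<close>

lemma eventually_interior:
  assumes N: "compact N" "K \<subseteq> interior N" "N \<subseteq> A" and Z: "compact Z" "Z \<subseteq> A - K"
  obtains T where "T > 0" "\<And>x t. x \<in> Z \<Longrightarrow> t \<ge> T \<Longrightarrow> \<phi> x t \<in> interior N"
proof -
  obtain T where T: "T > 0" "\<And>x t. x \<in> Z \<Longrightarrow> \<bar>t\<bar> \<ge> T \<Longrightarrow> \<phi> x t \<notin> frontier N"
    using no_return[OF Z frontier_neighbourhood[OF N]] by blast
  have "\<phi> x ` {T..} \<subseteq> interior N" if "x \<in> Z" for x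
  proof (rule connected_subset_interior)
    show "connected (\<phi> x ` {T..})" by (intro connected_orbit_segment) simp
    have "omega_limit \<phi> x \<inter> interior N \<noteq> {}"
      using Z(2) \<open>x \<in> Z\<close> N(2) by (intro omega_limit_meets) auto
    then obtain u where "u \<ge> T" "\<phi> x u \<in> interior N"
      using omega_limit_visits[OF open_interior] by blast
    then show "\<phi> x ` {T..} \<inter> interior N \<noteq> {}" by auto
    show "\<phi> x ` {T..} \<inter> frontier N = {}"
      using T(1) T(2)[OF \<open>x \<in> Z\<close>] by auto
  qed
  then show ?thesis using that[OF T(1)] by auto
qed

section \<open>Homoclinic points\<close>

lemma mem_H_iff: "x \<in> H \<longleftrightarrow> x \<in> A \<and> alpha_limit \<phi> x \<noteq> {} \<and> alpha_limit \<phi> x \<subseteq> K"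
  unfolding homoclinic_points_def basin_def by auto

lemma H_sub_A: "H \<subseteq> A"
  using mem_H_iff by blast

lemma alpha_limit_meets:
  assumes "x \<in> H" "K \<subseteq> U" shows "alpha_limit \<phi> x \<inter> U \<noteq> {}"
proof -
  have "alpha_limit \<phi> x \<noteq> {}" "alpha_limit \<phi> x \<subseteq> K" using assms(1) mem_H_iff by auto
  then show ?thesis using assms(2) by blast
qed

lemma flow_mem_H [simp]: "\<phi> x t \<in> H \<longleftrightarrow> x \<in> H"
  unfolding mem_H_iff by simp

text \<open>The alpha-limit set is nonempty, invariant and inside \<open>N\<close>, so isolation
  forces it into \<open>K\<close>.\<close>

lemma mem_H_of_backward_in_isolating:
  assumes N: "isolating_neighbourhood \<phi> K N" and "x \<in> A" and "\<And>t. t \<le> t0 \<Longrightarrow> \<phi> x t \<in> N"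
  shows "x \<in> H"
proof -
  note N = isolating_neighbourhoodD[OF N]
  have \<alpha>: "alpha_limit \<phi> x \<noteq> {}" "alpha_limit \<phi> x \<subseteq> N"
    using alpha_limit_nonempty[OF N(1) assms(3)] by blast+
  moreover have "range (\<phi> y) \<subseteq> N" if "y \<in> alpha_limit \<phi> x" for y
    using flow_mem_alpha_limit[OF that, of _ 0] \<alpha>(2) by auto
  ultimately show ?thesis using \<open>x \<in> A\<close> N(3) unfolding mem_H_iff by blast
qed

lemma K_sub_H: "K \<subseteq> H"
proof
  fix x assume "x \<in> K"
  then show "x \<in> H"
    using alpha_limit_nonempty[OF compact_K, of 0 x] K_sub_A unfolding mem_H_iff by auto
qed

text \<open>Time-reversed \<open>eventually_interior\<close>: homoclinicity supplies in the past the
  visits to \<open>interior N\<close> that the basin supplies in the future.\<close>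

lemma eventually_interior_backward:
  assumes N: "compact N" "K \<subseteq> interior N" "N \<subseteq> A" and Z: "compact Z" "Z \<subseteq> H - K"
  obtains T where "T > 0" "\<And>x t. x \<in> Z \<Longrightarrow> t \<le> - T \<Longrightarrow> \<phi> x t \<in> interior N"
proof -
  have ZA: "Z \<subseteq> A - K" using Z(2) H_sub_A by blast
  obtain T where T: "T > 0" "\<And>x t. x \<in> Z \<Longrightarrow> \<bar>t\<bar> \<ge> T \<Longrightarrow> \<phi> x t \<notin> frontier N"
    using no_return[OF Z(1) ZA frontier_neighbourhood[OF N]] by blast
  have "\<phi> x ` {..- T} \<subseteq> interior N" if "x \<in> Z" for x
  proof (rule connected_subset_interior)
    show "connected (\<phi> x ` {..- T})" by (intro connected_orbit_segment) simp
    have "alpha_limit \<phi> x \<inter> interior N \<noteq> {}"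
      using Z(2) \<open>x \<in> Z\<close> N(2) by (intro alpha_limit_meets) auto
    then obtain u where "u \<le> - T" "\<phi> x u \<in> interior N"
      using alpha_limit_visits[OF open_interior] by blast
    then show "\<phi> x ` {..- T} \<inter> interior N \<noteq> {}" by auto
    show "\<phi> x ` {..- T} \<inter> frontier N = {}"
      using T(1) T(2)[OF \<open>x \<in> Z\<close>] by auto
  qed
  then show ?thesis using that[OF T(1)] by auto
qed

text \<open>
  Near a point \<open>x\<close> of \<open>A - K\<close> there is a common time \<open>T < 0\<close> before which no orbit meets \<open>\<partial>N\<close>;
  whether \<open>y\<close> is homoclinic is then decided by the side of \<open>\<partial>N\<close> on which \<open>y \<cdot> T\<close> lies.
\<close>

lemma open_H_diff_K: "open (H - K)" and open_A_diff_H: "open (A - H)"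
proof -
  obtain N where N: "compact N" "K \<subseteq> interior N" "N \<subseteq> A" "isolating_neighbourhood \<phi> K N"
    by (rule isolating_neighbourhood_within[OF open_UNIV subset_UNIV])
  have loc: "\<exists>V T. open V \<and> x \<in> V \<and> V \<subseteq> A - K \<and>
      (\<forall>y\<in>V. (\<phi> y T \<in> interior N \<longrightarrow> y \<in> H) \<and> (\<phi> y T \<notin> N \<longrightarrow> y \<notin> H) \<and> \<phi> y T \<notin> frontier N)"
    if "x \<in> A - K" for x
  proof -
    have "{x} \<subseteq> A - K" using that by blast
    then obtain V where V: "compact V" "{x} \<subseteq> interior V" "V \<subseteq> A - K"
      by (rule locally_compact_neighbourhood[OF loc_compact compact_sing open_A_diff_K])
    obtain T where T: "T > 0" "\<And>x t. x \<in> V \<Longrightarrow> \<bar>t\<bar> \<ge> T \<Longrightarrow> \<phi> x t \<notin> frontier N"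
      using no_return[OF V(1,3) frontier_neighbourhood[OF N(1-3)]] by blast
    have "(\<phi> y (- T) \<in> interior N \<longrightarrow> y \<in> H) \<and> (\<phi> y (- T) \<notin> N \<longrightarrow> y \<notin> H) \<and> \<phi> y (- T) \<notin> frontier N"
      if "y \<in> V" for y
    proof (intro conjI impI)
      have seg: "connected (\<phi> y ` {..- T})" "\<phi> y ` {..- T} \<inter> frontier N = {}"
        using T(1) T(2)[OF that] by (auto intro!: connected_orbit_segment)
      show "y \<in> H" if "\<phi> y (- T) \<in> interior N"
      proof (rule mem_H_of_backward_in_isolating[OF N(4)])
        show "y \<in> A" using V \<open>y \<in> V\<close> by blast
        have "\<phi> y ` {..- T} \<subseteq> interior N"
          using that by (intro connected_subset_interior seg) auto
        then show "\<phi> y t \<in> N" if "t \<le> - T" for t using that interior_subset[of N] by auto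
      qed
      \<comment> \<open>A homoclinic orbit visits \<open>interior N\<close> before time
        \<open>- T\<close>, so the whole backward half-orbit, which misses the frontier, would lie
        inside.\<close>
      show "y \<notin> H" if "\<phi> y (- T) \<notin> N"
      proof
        assume "y \<in> H"
        then have "alpha_limit \<phi> y \<inter> interior N \<noteq> {}" using N(2) by (intro alpha_limit_meets)
        then obtain u where "u \<le> - T" "\<phi> y u \<in> interior N"
          using alpha_limit_visits[OF open_interior] by blast
        then have "\<phi> y ` {..- T} \<subseteq> interior N"
          by (intro connected_subset_interior seg) auto
        then show False using that interior_subset[of N] by auto
      qed
      show "\<phi> y (- T) \<notin> frontier N" using T(1) T(2)[OF that] by auto
    qed
    then show ?thesis using V interior_subset[of V] open_interior[of V] by blast
  qed
  show "open (H - K)"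
  proof (subst open_subopen, intro ballI)
    fix x assume x: "x \<in> H - K"
    then obtain V T where V: "open V" "x \<in> V" "V \<subseteq> A - K"
      "\<forall>y\<in>V. (\<phi> y T \<in> interior N \<longrightarrow> y \<in> H) \<and> (\<phi> y T \<notin> N \<longrightarrow> y \<notin> H) \<and> \<phi> y T \<notin> frontier N"
      using loc[of x] H_sub_A by blast
    \<comment> \<open>Homoclinicity of \<open>x\<close> excludes the exterior of \<open>N\<close>,
      the choice of \<open>V\<close> excludes the frontier. The remaining case
      \<open>\<phi> x T \<in> interior N\<close> persists near \<open>x\<close> and makes nearby
      points homoclinic.\<close>
    have "\<phi> x T \<in> N" "\<phi> x T \<notin> frontier N" using V x by blast+
    then have "\<phi> x T \<in> interior N" using closure_subset[of N] unfolding frontier_def by blast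
    moreover have "V \<inter> {y. \<phi> y T \<in> interior N} \<subseteq> H - K" using V by blast
    moreover have "open (V \<inter> {y. \<phi> y T \<in> interior N})"
      using V(1) open_flow_preimage[OF open_interior] by blast
    ultimately show "\<exists>T. open T \<and> x \<in> T \<and> T \<subseteq> H - K" using V(2) by blast
  qed
  show "open (A - H)"
  proof (subst open_subopen, intro ballI)
    fix x assume x: "x \<in> A - H"
    then obtain V T where V: "open V" "x \<in> V" "V \<subseteq> A - K"
      "\<forall>y\<in>V. (\<phi> y T \<in> interior N \<longrightarrow> y \<in> H) \<and> (\<phi> y T \<notin> N \<longrightarrow> y \<notin> H) \<and> \<phi> y T \<notin> frontier N"
      using loc[of x] K_sub_H by blast
    have "\<phi> x T \<notin> interior N" "\<phi> x T \<notin> frontier N" using V x by blast+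
    then have "\<phi> x T \<in> - N" using closure_subset[of N] unfolding frontier_def by blast
    moreover have "V \<inter> {y. \<phi> y T \<in> - N} \<subseteq> A - H" using V by blast
    moreover have "open (V \<inter> {y. \<phi> y T \<in> - N})"
      using V(1) open_flow_preimage[of "- N"] compact_imp_closed[OF N(1)] by blast
    ultimately show "\<exists>T. open T \<and> x \<in> T \<and> T \<subseteq> A - H" using V(2) by blast
  qed
qed

text \<open>The orbit enters \<open>N\<close> because its omega-limit set lies in \<open>K\<close>,
  and it leaves \<open>N\<close> because isolation would otherwise put \<open>x\<close> in
  \<open>K\<close>.\<close>

lemma orbit_meets_frontier:
  assumes "isolating_neighbourhood \<phi> K N" "x \<in> A - K"
  obtains t where "\<phi> x t \<in> frontier N"
proof -
  note N = isolating_neighbourhoodD[OF assms(1)]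
  have "omega_limit \<phi> x \<inter> interior N \<noteq> {}" using assms(2) N(2) by (intro omega_limit_meets) auto
  then obtain u where "\<phi> x u \<in> interior N" using omega_limit_visits[OF open_interior] by metis
  then have "range (\<phi> x) \<inter> N \<noteq> {}" using interior_subset by blast
  moreover have "range (\<phi> x) - N \<noteq> {}"
  proof
    assume "range (\<phi> x) - N = {}"
    then have "range (\<phi> x) \<subseteq> N" by blast
    moreover have "x \<in> N" using calculation flow_0[of x] by (metis rangeI subsetD)
    ultimately show False using N(3) assms(2) by blast
  qed
  ultimately have "range (\<phi> x) \<inter> frontier N \<noteq> {}"
    by (intro connected_Int_frontier connected_orbit_segment) auto
  then show ?thesis using that by blast
qed

section \<open>The stabilization\<close>

text \<open>An orbit starting in \<open>N\<close> can leave it only through the frontier, and a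
  fixed time \<open>T\<close> after any crossing it is back in \<open>interior N\<close> for good.
  Forward orbits from \<open>N\<close> thus stay in a compact set, which also contains the closures
  defining J+.\<close>

lemma prolongational_limit_bound:
  obtains Q where "compact Q" "Q \<subseteq> A" "\<And>x. x \<in> K \<Longrightarrow> prolongational_limit \<phi> x \<subseteq> Q"
proof -
  obtain N where N: "compact N" "K \<subseteq> interior N" "N \<subseteq> A"
    by (rule isolating_neighbourhood_within[OF open_UNIV subset_UNIV])
  obtain T where T: "T > 0" "\<And>x t. x \<in> frontier N \<Longrightarrow> t \<ge> T \<Longrightarrow> \<phi> x t \<in> interior N"
    using eventually_interior[OF N frontier_neighbourhood[OF N]] by blast
  define Q where "Q = N \<union> (\<lambda>(x, t). \<phi> x t) ` (frontier N \<times> {0..T})"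
  have Q: "compact Q"
    unfolding Q_def
    by (intro compact_Un compact_flow_image N(1) frontier_neighbourhood(1)[OF N] compact_Icc)
  have orbit: "\<phi> x t \<in> Q" if xt: "x \<in> N" "t \<ge> 0" for x t
  proof (cases "\<phi> x t \<in> N")
    case False
    have "\<phi> x ` {0..t} \<inter> frontier N \<noteq> {}"
    proof (rule connected_Int_frontier)
      show "connected (\<phi> x ` {0..t})" by (intro connected_orbit_segment) simp
      show "\<phi> x ` {0..t} \<inter> N \<noteq> {}" using xt flow_0[of x] by force
      show "\<phi> x ` {0..t} - N \<noteq> {}" using xt(2) False by force
    qed
    then obtain s where s: "0 \<le> s" "s \<le> t" "\<phi> x s \<in> frontier N" by auto
    \<comment> \<open>Any crossing time \<open>s\<close> will do; it need not be the last one before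
      \<open>t\<close>.\<close>
    have "t - s < T"
    proof (rule ccontr)
      assume "\<not> t - s < T"
      then have "\<phi> (\<phi> x s) (t - s) \<in> interior N" by (intro T(2) s) simp
      then show False using False interior_subset[of N] by auto
    qed
    then have "\<phi> x t \<in> (\<lambda>(x, t). \<phi> x t) ` (frontier N \<times> {0..T})"
      using s by (intro image_eqI[of _ _ "(\<phi> x s, t - s)"]) auto
    then show ?thesis unfolding Q_def by blast
  qed (simp add: Q_def)
  show ?thesis
  proof
    have "frontier N \<subseteq> A" using frontier_neighbourhood(2)[OF N] by blast
    then show "Q \<subseteq> A" using N(3) unfolding Q_def by (auto dest: subsetD)
    show "prolongational_limit \<phi> x \<subseteq> Q" if "x \<in> K" for x
    proof -
      have "prolongational_limit \<phi> x \<subseteq> closure (\<Union>y\<in>interior N. \<phi> y ` {0..})"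
      proof
        fix y assume "y \<in> prolongational_limit \<phi> x"
        then show "y \<in> closure (\<Union>y\<in>interior N. \<phi> y ` {0..})"
          unfolding prolongational_limit_def using that N(2) by auto
      qed
      also have "\<dots> \<subseteq> Q"
      proof (rule closure_minimal)
        show "(\<Union>y\<in>interior N. \<phi> y ` {0..}) \<subseteq> Q"
          using orbit interior_subset[of N] by fastforce
      qed (rule compact_imp_closed[OF Q])
      finally show ?thesis .
    qed
  qed (rule Q)
qed

text \<open>J+ is invariant, so the orbit of a point \<open>y\<close> of J+(x) stays in the compact
  set \<open>Q\<close> inside the basin. A point \<open>w\<close> of its alpha-limit set outside
  \<open>K\<close> would give y in J+(w), hence \<open>y \<in> K\<close>. Conversely, a homoclinic
  \<open>y\<close> lies in J+(x) for any \<open>x\<close> in its alpha-limit set.\<close>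

lemma stabilization_eq: "stabilization \<phi> K = H"
proof
  obtain Q where Q: "compact Q" "Q \<subseteq> A" "\<And>x. x \<in> K \<Longrightarrow> prolongational_limit \<phi> x \<subseteq> Q"
    using prolongational_limit_bound by blast
  show "stabilization \<phi> K \<subseteq> H"
  proof
    fix y assume "y \<in> stabilization \<phi> K"
    then obtain x where x: "x \<in> K" "y \<in> prolongational_limit \<phi> x"
      unfolding stabilization_def by blast
    then have orbit: "\<phi> y t \<in> Q" for t using flow_mem_prolongational_limit Q(3) by blast
    then have "y \<in> A" using Q(2) flow_0[of y] by (metis subsetD)
    have "w \<in> K" if "y \<notin> K" "w \<in> alpha_limit \<phi> y" for w
    proof (rule ccontr)
      assume "w \<notin> K"
      then have "w \<in> A - K"
        using Q(2) alpha_limit_nonempty(2)[OF Q(1) orbit] that by blast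
      then show False
        using subsetD[OF prolongational_limit_sub_K mem_prolongational_limit_alpha[OF that(2)]] that(1)
        by blast
    qed
    then show "y \<in> H"
      using K_sub_H \<open>y \<in> A\<close> alpha_limit_nonempty(1)[OF Q(1) orbit] mem_H_iff[of y]
      by (cases "y \<in> K") auto
  qed
  show "H \<subseteq> stabilization \<phi> K"
  proof
    fix y assume "y \<in> H"
    then obtain x where "x \<in> alpha_limit \<phi> y" "x \<in> K" using alpha_limit_meets[of y K] by blast
    then show "y \<in> stabilization \<phi> K"
      unfolding stabilization_def using mem_prolongational_limit_alpha by blast
  qed
qed

section \<open>A time coordinate on \<open>A - K\<close>\<close>

text \<open>The function is the distance to the complement of \<open>interior Z\<close>, where
  \<open>Z\<close> is a compact neighbourhood of the frontier of an isolating neighbourhood; every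
  orbit of \<open>A - K\<close> crosses that frontier.\<close>

lemma bump_function:
  obtains h :: "'a \<Rightarrow> real" and Z where "continuous_on UNIV h" "\<And>x. h x \<ge> 0"
    "compact Z" "Z \<subseteq> A - K" "\<And>x. x \<notin> Z \<Longrightarrow> h x = 0" "\<And>x. x \<in> A - K \<Longrightarrow> \<exists>t. h (\<phi> x t) \<noteq> 0"
proof -
  obtain N where N: "compact N" "K \<subseteq> interior N" "N \<subseteq> A" "isolating_neighbourhood \<phi> K N"
    by (rule isolating_neighbourhood_within[OF open_UNIV subset_UNIV])
  obtain Z where Z: "compact Z" "frontier N \<subseteq> interior Z" "Z \<subseteq> A - K"
    by (rule locally_compact_neighbourhood[OF loc_compact frontier_neighbourhood(1)[OF N(1-3)]
          open_A_diff_K frontier_neighbourhood(2)[OF N(1-3)]])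
  define h where "h x = infdist x (- interior Z)" for x
  show ?thesis
  proof
    show "continuous_on UNIV h" unfolding h_def by (intro continuous_intros)
    show "h x \<ge> 0" for x unfolding h_def by (rule infdist_nonneg)
    show "compact Z" "Z \<subseteq> A - K" by (rule Z)+
    show "h x = 0" if "x \<notin> Z" for x
      unfolding h_def using that interior_subset[of Z] by (intro infdist_zero) auto
    show "\<exists>t. h (\<phi> x t) \<noteq> 0" if x: "x \<in> A - K" for x
    proof -
      obtain t where t: "\<phi> x t \<in> frontier N" by (rule orbit_meets_frontier[OF N(4) x])
      \<comment> \<open>\<open>infdist\<close> to the empty set is \<open>0\<close> by convention,
        so the complement of \<open>interior Z\<close> must be shown nonempty; it contains
        \<open>K\<close>.\<close>
      have "K \<noteq> {}" using omega_limit_meets[of x K] x by blast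
      then have "- interior Z \<noteq> {}" using Z(3) interior_subset[of Z] by blast
      moreover have "\<phi> x t \<notin> - interior Z" using t Z(2) by blast
      ultimately have "h (\<phi> x t) \<noteq> 0"
        unfolding h_def using in_closed_iff_infdist_zero[of "- interior Z" "\<phi> x t"] open_interior[of Z]
        by (simp add: closed_Compl)
      then show ?thesis by blast
    qed
  qed
qed

lemma section_function:
  obtains \<tau> where "continuous_on (A - K) \<tau>"
    "\<And>x t. x \<in> A - K \<Longrightarrow> \<tau> (\<phi> x t) = \<tau> x + t" "compact {x \<in> A - K. \<tau> x = 0}"
proof -
  obtain h :: "'a \<Rightarrow> real" and Z where cont_h: "continuous_on UNIV h" and h_nonneg: "\<And>x. h x \<ge> 0"
    and Z: "compact Z" "Z \<subseteq> A - K" "\<And>x. x \<notin> Z \<Longrightarrow> h x = 0"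
    and h_orbit: "\<And>x. x \<in> A - K \<Longrightarrow> \<exists>t. h (\<phi> x t) \<noteq> 0"
    by (rule bump_function) (rule that; assumption)
  have cont: "continuous_on S (\<lambda>x. h (\<phi> (f x) (g x)))"
    if "continuous_on S f" "continuous_on S g" for S :: "'b::topological_space set" and f g
    by (rule continuous_on_compose2[OF cont_h continuous_on_flow[OF that]]) simp
  have cont1: "continuous_on UNIV (\<lambda>t. h (\<phi> x t))" for x
    by (intro cont continuous_intros)
  \<comment> \<open>By \<open>no_return\<close> the time support is bounded uniformly near
    \<open>x\<close>, which is what continuity of the integrals requires.\<close>
  have supp: "\<exists>V R. open V \<and> x \<in> V \<and> V \<subseteq> A - K \<and> (\<forall>y\<in>V. \<forall>t. \<bar>t\<bar> \<ge> R \<longrightarrow> h (\<phi> y t) = 0)"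
    if x: "x \<in> A - K" for x
  proof -
    have "{x} \<subseteq> A - K" using x by blast
    then obtain V where V: "compact V" "{x} \<subseteq> interior V" "V \<subseteq> A - K"
      by (rule locally_compact_neighbourhood[OF loc_compact compact_sing open_A_diff_K])
    obtain R where "R > 0" "\<And>y t. y \<in> V \<Longrightarrow> \<bar>t\<bar> \<ge> R \<Longrightarrow> \<phi> y t \<notin> Z"
      using no_return[OF V(1,3) Z(1,2)] by blast
    then have "\<forall>y\<in>interior V. \<forall>t. \<bar>t\<bar> \<ge> R \<longrightarrow> h (\<phi> y t) = 0"
      using Z(3) interior_subset[of V] by blast
    moreover have "x \<in> interior V" "interior V \<subseteq> A - K" using V interior_subset[of V] by blast+
    ultimately show ?thesis using open_interior[of V] by blast
  qed
  have pos: "integral UNIV (\<lambda>t. h (\<phi> x t)) > 0" if x: "x \<in> A - K" for x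
  proof -
    obtain R where "\<forall>t. \<bar>t\<bar> \<ge> R \<longrightarrow> h (\<phi> x t) = 0" using supp[OF x] by blast
    moreover obtain t where "h (\<phi> x t) \<noteq> 0" using h_orbit[OF x] by blast
    ultimately show ?thesis by (intro integral_UNIV_pos[OF cont1, of R] h_nonneg) auto
  qed
  \<comment> \<open>Starting later on an orbit moves the bump earlier in time; the minus sign makes
    \<tau> increase along the flow.\<close>
  define \<tau> where "\<tau> x = - barycentre (\<lambda>t. h (\<phi> x t))" for x
  show ?thesis
  proof
    show "continuous_on (A - K) \<tau>"
    proof (subst continuous_on_eq_continuous_at[OF open_A_diff_K], intro ballI)
      fix x assume x: "x \<in> A - K"
      obtain V R where V: "open V" "x \<in> V" "V \<subseteq> A - K"
        and R: "\<And>y t. y \<in> V \<Longrightarrow> \<bar>t\<bar> \<ge> R \<Longrightarrow> h (\<phi> y t) = 0"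
        using supp[OF x] by blast
      \<comment> \<open>Near \<open>x\<close> both moments are integrals over one fixed compact
        interval, so continuity in the parameter applies.\<close>
      have eq: "integral UNIV (\<lambda>t. h (\<phi> y t)) = integral (cbox (-R) R) (\<lambda>t. h (\<phi> y t))"
        "integral UNIV (\<lambda>t. t * h (\<phi> y t)) = integral (cbox (-R) R) (\<lambda>t. t * h (\<phi> y t))"
        if "y \<in> V" for y
      proof -
        show "integral UNIV (\<lambda>t. h (\<phi> y t)) = integral (cbox (-R) R) (\<lambda>t. h (\<phi> y t))"
          using has_integral_UNIV_of_support[OF cont1, of R y] R[OF that]
          by (simp add: integral_unique)
        have "((\<lambda>t. t * h (\<phi> y t)) has_integral integral {-R..R} (\<lambda>t. t * h (\<phi> y t))) UNIV"
          using R[OF that]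
          by (intro has_integral_UNIV_of_support continuous_on_mult continuous_on_id cont1) simp
        then show "integral UNIV (\<lambda>t. t * h (\<phi> y t)) = integral (cbox (-R) R) (\<lambda>t. t * h (\<phi> y t))"
          by (simp add: integral_unique)
      qed
      have c1: "continuous_on V (\<lambda>y. integral (cbox (-R) R) (\<lambda>t. h (\<phi> y t)))"
        by (rule integral_continuous_on_param)
          (unfold case_prod_beta, intro cont continuous_intros)
      have c2: "continuous_on V (\<lambda>y. integral (cbox (-R) R) (\<lambda>t. t * h (\<phi> y t)))"
        by (rule integral_continuous_on_param)
          (unfold case_prod_beta, intro continuous_on_mult cont continuous_intros)
      have "continuous_on V (\<lambda>y. - (integral (cbox (-R) R) (\<lambda>t. t * h (\<phi> y t)) /
          integral (cbox (-R) R) (\<lambda>t. h (\<phi> y t))))"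
      proof (intro continuous_on_minus continuous_on_divide c1 c2 ballI)
        show "integral (cbox (-R) R) (\<lambda>t. h (\<phi> y t)) \<noteq> 0" if y: "y \<in> V" for y
          using pos[of y] y V(3) unfolding eq(1)[OF y] by auto
      qed
      also have "?this \<longleftrightarrow> continuous_on V \<tau>"
        by (intro continuous_on_cong refl) (simp only: \<tau>_def barycentre_def eq)
      finally show "isCont \<tau> x"
        using V by (simp add: continuous_on_eq_continuous_at)
    qed
    show \<tau>_flow: "\<tau> (\<phi> x s) = \<tau> x + s" if x: "x \<in> A - K" for x s
    proof -
      obtain R where R: "\<And>t. \<bar>t\<bar> \<ge> R \<Longrightarrow> h (\<phi> x t) = 0" using supp[OF x] by blast
      have "integral UNIV (\<lambda>t. h (\<phi> x t)) \<noteq> 0" using pos[OF x] by simp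
      then show ?thesis
        using barycentre_shift[OF cont1 R, where s = s] unfolding \<tau>_def by (simp add: add.commute)
    qed
    obtain T where T: "T > 0" "\<And>x t. x \<in> Z \<Longrightarrow> \<bar>t\<bar> \<ge> T \<Longrightarrow> \<phi> x t \<notin> Z"
      using no_return[OF Z(1,2) Z(1,2)] by blast
    \<comment> \<open>Two visits to \<open>Z\<close> along one orbit are less than \<open>T\<close>
      apart. A zero of \<tau> has visits at times \<open>t1 \<le> 0 \<le> t2\<close>, hence is
      reached from \<open>Z\<close> within time \<open>T\<close>.\<close>
    define B where "B = (\<lambda>(x, t). \<phi> x t) ` (Z \<times> {0..T})"
    have "compact B" unfolding B_def by (intro compact_flow_image Z compact_Icc)
    have "B \<subseteq> A - K" using Z(2) unfolding B_def by auto
    have zero: "x \<in> B" if x: "x \<in> A - K" "\<tau> x = 0" for x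
    proof -
      obtain R where R: "\<And>t. \<bar>t\<bar> \<ge> R \<Longrightarrow> h (\<phi> x t) = 0" using supp[OF x(1)] by blast
      obtain t0 where t0: "h (\<phi> x t0) \<noteq> 0" using h_orbit[OF x(1)] by blast
      have "barycentre (\<lambda>t. h (\<phi> x t)) = 0" using x(2) unfolding \<tau>_def by simp
      then obtain t1 t2 where t: "t1 \<le> 0" "0 \<le> t2" "h (\<phi> x t1) \<noteq> 0" "h (\<phi> x t2) \<noteq> 0"
        using barycentre_eq_0[where f = "\<lambda>t. h (\<phi> x t)" and R = R, OF cont1 R h_nonneg t0]
        by blast
      then have "\<phi> x t1 \<in> Z" "\<phi> (\<phi> x t1) (t2 - t1) \<in> Z" using Z(3) by auto
      then have "\<bar>t2 - t1\<bar> < T" using T(2)[of "\<phi> x t1" "t2 - t1"] by (meson not_le)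
      then show ?thesis
        unfolding B_def using t \<open>\<phi> x t1 \<in> Z\<close> by (intro image_eqI[of _ _ "(\<phi> x t1, - t1)"]) auto
    qed
    have "continuous_on B \<tau>"
      using \<open>continuous_on (A - K) \<tau>\<close> \<open>B \<subseteq> A - K\<close> continuous_on_subset by blast
    then have "closed (B \<inter> \<tau> -` {0})"
      using compact_imp_closed[OF \<open>compact B\<close>] by (intro continuous_closed_preimage) auto
    then have "compact (B \<inter> (B \<inter> \<tau> -` {0}))" by (intro compact_Int_closed \<open>compact B\<close>)
    moreover have "B \<inter> (B \<inter> \<tau> -` {0}) = {x \<in> A - K. \<tau> x = 0}"
      using zero \<open>B \<subseteq> A - K\<close> by blast
    ultimately show "compact {x \<in> A - K. \<tau> x = 0}" by simp
  qed
qed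

end

section \<open>Isolating blocks\<close>

locale attractor_section = attractor \<phi> K for \<phi> :: "'a::metric_space \<Rightarrow> real \<Rightarrow> 'a" and K :: "'a set" +
  fixes \<tau> :: "'a \<Rightarrow> real"
  assumes continuous_\<tau>: "continuous_on (A - K) \<tau>"
    and \<tau>_flow [simp]: "x \<in> A \<Longrightarrow> x \<notin> K \<Longrightarrow> \<tau> (\<phi> x t) = \<tau> x + t"
    and compact_zero_set: "compact {x \<in> A - K. \<tau> x = 0}"
begin

section \<open>Level sets and blocks\<close>

definition slice :: "real \<Rightarrow> 'a set" where
  "slice s = {x \<in> A - K. \<tau> x = s}"

text \<open>Homoclinic orbits also emanate from \<open>K\<close>, so their points with very negative
  \<tau> must belong to a neighbourhood of \<open>K\<close>; other orbits contribute only their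
  forward ends.\<close>

definition block :: "real \<Rightarrow> 'a set" where
  "block T = K \<union> {x \<in> A - K. \<tau> x \<ge> T} \<union> {x \<in> H - K. \<tau> x \<le> - T}"

lemma flow_mem_slice: "x \<in> A - K \<Longrightarrow> \<phi> x (s - \<tau> x) \<in> slice s"
  unfolding slice_def by simp

lemma compact_band: "compact {x \<in> A - K. a \<le> \<tau> x \<and> \<tau> x \<le> b}"
proof -
  \<comment> \<open>Sliding along orbits to level \<open>0\<close> exhibits the band as a flow image
    of a compact product.\<close>
  have "{x \<in> A - K. a \<le> \<tau> x \<and> \<tau> x \<le> b} = (\<lambda>(x, t). \<phi> x t) ` (slice 0 \<times> {a..b})"
  proof
    show "{x \<in> A - K. a \<le> \<tau> x \<and> \<tau> x \<le> b} \<subseteq> (\<lambda>(x, t). \<phi> x t) ` (slice 0 \<times> {a..b})"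
    proof
      fix x assume x: "x \<in> {x \<in> A - K. a \<le> \<tau> x \<and> \<tau> x \<le> b}"
      then have "\<phi> x (0 - \<tau> x) \<in> slice 0" by (intro flow_mem_slice) simp
      then show "x \<in> (\<lambda>(x, t). \<phi> x t) ` (slice 0 \<times> {a..b})"
        using x by (intro image_eqI[of _ _ "(\<phi> x (0 - \<tau> x), \<tau> x)"]) simp_all
    qed
  qed (auto simp: slice_def)
  then show ?thesis
    using compact_flow_image[OF compact_zero_set compact_Icc] by (simp add: slice_def)
qed

lemma compact_slice: "compact (slice s)"
proof -
  have "slice s = {x \<in> A - K. s \<le> \<tau> x \<and> \<tau> x \<le> s}" unfolding slice_def by auto
  then show ?thesis using compact_band by simp
qed

lemma open_less: "open {x \<in> A - K. \<tau> x < s}" and open_greater: "open {x \<in> A - K. s < \<tau> x}"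
proof -
  have "open ((A - K) \<inter> \<tau> -` {..<s})" "open ((A - K) \<inter> \<tau> -` {s<..})"
    by (intro continuous_open_preimage continuous_\<tau> open_A_diff_K open_lessThan open_greaterThan)+
  moreover have "(A - K) \<inter> \<tau> -` {..<s} = {x \<in> A - K. \<tau> x < s}"
    "(A - K) \<inter> \<tau> -` {s<..} = {x \<in> A - K. s < \<tau> x}" by auto
  ultimately show "open {x \<in> A - K. \<tau> x < s}" "open {x \<in> A - K. s < \<tau> x}" by simp_all
qed

text \<open>Points of \<open>block T\<close> outside \<open>K\<close> are reached from
  \<open>slice 0\<close> in time at least \<open>T\<close>, forward, or backward if homoclinic; both
  ends enter \<open>N\<close> uniformly.\<close>

lemma block_within:
  assumes "open U" "K \<subseteq> U"
  obtains T0 where "T0 > 0" "\<And>T. T \<ge> T0 \<Longrightarrow> block T \<subseteq> U"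
proof -
  obtain N where N: "compact N" "K \<subseteq> interior N" "N \<subseteq> U" "N \<subseteq> A"
    by (rule isolating_neighbourhood_within[OF assms])
  have slice0: "slice 0 \<subseteq> A - K" unfolding slice_def by blast
  obtain T1 where T1: "T1 > 0" "\<And>x t. x \<in> slice 0 \<Longrightarrow> t \<ge> T1 \<Longrightarrow> \<phi> x t \<in> interior N"
    using eventually_interior[OF N(1,2,4) compact_slice slice0] by blast
  \<comment> \<open>This is the homoclinic part of \<open>slice 0\<close>, compact because
    \<open>A - H\<close> is open.\<close>
  have "compact (slice 0 - (A - H))" by (intro compact_diff compact_slice open_A_diff_H)
  moreover have "slice 0 - (A - H) \<subseteq> H - K" unfolding slice_def by blast
  ultimately obtain T2 where
    T2: "T2 > 0" "\<And>x t. x \<in> slice 0 - (A - H) \<Longrightarrow> t \<le> - T2 \<Longrightarrow> \<phi> x t \<in> interior N"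
    using eventually_interior_backward[OF N(1,2,4)] by blast
  show ?thesis
  proof
    show "max T1 T2 > 0" using T1 by simp
    show "block T \<subseteq> U" if T: "T \<ge> max T1 T2" for T
    proof
      fix x assume "x \<in> block T"
      then consider "x \<in> K" | "x \<in> A - K" "\<tau> x \<ge> T" | "x \<in> H - K" "\<tau> x \<le> - T"
        unfolding block_def by blast
      then have "x \<in> interior N"
      proof cases
        case 1 then show ?thesis using N(2) by blast
      next
        case 2
        then have "\<phi> (\<phi> x (0 - \<tau> x)) (\<tau> x) \<in> interior N"
          using T by (intro T1(2) flow_mem_slice) auto
        then show ?thesis by simp
      next
        case 3
        then have "x \<in> A - K" using H_sub_A by blast
        then have "\<phi> (\<phi> x (0 - \<tau> x)) (\<tau> x) \<in> interior N"
          using 3 T flow_mem_slice[of x 0] by (intro T2(2)) auto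
        then show ?thesis by simp
      qed
      then show "x \<in> U" using N(3) interior_subset[of N] by blast
    qed
  qed
qed

text \<open>The points to exclude near \<open>K\<close> are non-homoclinic with very negative
  \<tau>: they would reach the non-homoclinic part of \<open>slice 0\<close> after a long time. That
  part is compact and misses the stabilization, so separation forbids this.\<close>

lemma K_sub_interior_block: "K \<subseteq> interior (block T)"
proof -
  have cS: "compact (slice 0 - (H - K))" by (intro compact_diff compact_slice open_H_diff_K)
  have J: "prolongational_limit \<phi> x \<inter> (slice 0 - (H - K)) = {}" if "x \<in> K" for x
  proof -
    have "prolongational_limit \<phi> x \<subseteq> stabilization \<phi> K" unfolding stabilization_def using that by blast
    then show ?thesis unfolding stabilization_eq slice_def by blast
  qed
  obtain U T1 where U: "open U" "K \<subseteq> U" "T1 > 0"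
    and T1: "\<And>x t. x \<in> U \<Longrightarrow> t \<ge> T1 \<Longrightarrow> \<phi> x t \<notin> slice 0 - (H - K)"
    using prolongational_limit_separation[OF compact_K cS J] by blast
  \<comment> \<open>Removing these compact bands, disjoint from \<open>K\<close>, leaves outside
    \<open>K\<close> only \<tau> above \<open>T\<close> or below both \<open>- T1\<close> and
    \<open>- T\<close>.\<close>
  define D where "D a = {x \<in> A - K. a \<le> \<tau> x \<and> \<tau> x \<le> T}" for a
  have D: "closed (D a)" "D a \<inter> K = {}" for a
    unfolding D_def using compact_band compact_imp_closed by blast+
  have "U \<inter> A - D (- T1) - D (- T) \<subseteq> interior (block T)"
  proof (rule interior_maximal)
    show "open (U \<inter> A - D (- T1) - D (- T))" using U open_A D(1) by blast
    show "U \<inter> A - D (- T1) - D (- T) \<subseteq> block T"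
    proof
      fix x assume x: "x \<in> U \<inter> A - D (- T1) - D (- T)"
      show "x \<in> block T"
      proof (cases "x \<in> K \<or> \<tau> x \<ge> T")
        case True
        then show ?thesis using x unfolding block_def by blast
      next
        case False
        then have less: "\<tau> x < - T1" "\<tau> x < - T" and xA: "x \<in> A - K" using x unfolding D_def by auto
        have "x \<in> H"
        proof (rule ccontr)
          assume "x \<notin> H"
          then have "\<phi> x (0 - \<tau> x) \<in> slice 0 - (H - K)" using flow_mem_slice[OF xA, of 0] by simp
          then show False using T1[of x "0 - \<tau> x"] x less by auto
        qed
        then show ?thesis using less xA unfolding block_def by auto
      qed
    qed
  qed
  moreover have "K \<subseteq> U \<inter> A - D (- T1) - D (- T)" using U K_sub_A D(2) by blast
  ultimately show ?thesis by blast
qed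

lemma compact_block:
  assumes "compact N" "block T \<subseteq> N" "N \<subseteq> A" shows "compact (block T)"
proof -
  \<comment> \<open>The complement of the block within the basin, written so that openness is
    evident.\<close>
  define G where "G = {x \<in> A - K. \<tau> x < T} \<inter> ((A - H) \<union> {x \<in> A - K. - T < \<tau> x})"
  have "open G" unfolding G_def using open_less open_greater open_A_diff_H by blast
  moreover have "block T = N - G"
  proof
    show "block T \<subseteq> N - G" using assms(2) unfolding block_def G_def by auto
    show "N - G \<subseteq> block T" using assms(3) unfolding block_def G_def by force
  qed
  ultimately show ?thesis using compact_diff[OF assms(1)] by simp
qed

lemma frontier_block:
  assumes "closed (block T)" "T > 0"
  shows "frontier (block T) = slice T \<union> (slice (- T) \<inter> H)"
proof -
  have fr: "frontier (block T) = block T - interior (block T)"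
    using assms(1) unfolding frontier_def by simp
  have "{x \<in> A - K. T < \<tau> x} \<subseteq> interior (block T)"
    by (intro interior_maximal open_greater) (auto simp: block_def)
  moreover have "(H - K) \<inter> {x \<in> A - K. \<tau> x < - T} \<subseteq> interior (block T)"
    by (intro interior_maximal open_Int open_H_diff_K open_less) (auto simp: block_def)
  ultimately have "block T - interior (block T) \<subseteq> slice T \<union> (slice (- T) \<inter> H)"
    using K_sub_interior_block[of T] H_sub_A unfolding slice_def block_def by (fastforce simp: less_le)
  moreover have "x \<in> block T - interior (block T)" if x: "x \<in> slice T \<union> (slice (- T) \<inter> H)" for x
  proof
    show "x \<in> block T" using x unfolding slice_def block_def by auto
    show "x \<notin> interior (block T)"
    proof
      assume "x \<in> interior (block T)"
      moreover have "open (\<phi> x -` interior (block T))"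
        by (intro open_vimage open_interior continuous_on_flow continuous_on_const continuous_on_id)
      ultimately obtain e where "e > 0" and "ball 0 e \<subseteq> \<phi> x -` interior (block T)"
        unfolding open_contains_ball by force
      then have e: "\<phi> x t \<in> block T" if "\<bar>t\<bar> < e" for t
        using that interior_subset[of "block T"] by (auto simp: subset_iff dist_real_def)
      \<comment> \<open>The bound \<open>d \<le> T\<close> ensures that moving by \<open>d\<close>
        from one bounding level into the gap does not overshoot to the other one.\<close>
      define d where "d = min (e / 2) T"
      have d: "0 < d" "d < e" "d \<le> T" unfolding d_def using \<open>e > 0\<close> \<open>T > 0\<close> by auto
      then have "\<phi> x (- d) \<in> block T" "\<phi> x d \<in> block T" by (intro e; simp)+
      moreover have "x \<in> A - K" "\<tau> x = T \<or> \<tau> x = - T" using x unfolding slice_def by auto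
      ultimately show False using d unfolding block_def by auto
    qed
  qed
  ultimately show ?thesis unfolding fr by blast
qed

lemma flow_block_forward: "x \<in> slice T \<Longrightarrow> t \<ge> 0 \<Longrightarrow> \<phi> x t \<in> block T"
  unfolding slice_def block_def by simp

lemma flow_block_backward: "x \<in> slice (- T) \<inter> H \<Longrightarrow> t \<le> 0 \<Longrightarrow> \<phi> x t \<in> block T"
  unfolding slice_def block_def by simp

section \<open>Components of \<open>A - K\<close>\<close>

context
  fixes C assumes C: "C \<in> components (A - K)"
begin

lemma component_sub: "C \<subseteq> A - K"
  by (rule in_components_subset[OF C])

lemma flow_mem_component [simp]: "\<phi> x t \<in> C \<longleftrightarrow> x \<in> C"
proof -
  have inv: "\<phi> y s \<in> C" if y: "y \<in> C" for y s
  proof -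
    have "range (\<phi> y) \<subseteq> C"
    proof (rule components_maximal[OF C])
      show "connected (range (\<phi> y))" by (intro connected_orbit_segment) simp
      show "range (\<phi> y) \<subseteq> A - K" using component_sub y by auto
      show "C \<inter> range (\<phi> y) \<noteq> {}" using y rangeI[of "\<phi> y" 0] by auto
    qed
    then show ?thesis by blast
  qed
  show ?thesis using inv[of x t] inv[of "\<phi> x t" "- t"] by auto
qed

lemma component_slice: "x \<in> C \<Longrightarrow> \<phi> x (s - \<tau> x) \<in> C \<inter> slice s"
  using flow_mem_slice[of x s] component_sub by auto

lemma compact_component_slice: "compact (C \<inter> slice s)"
proof -
  obtain D where D: "closed D" "C = (A - K) \<inter> D"
    using closedin_component[OF C] unfolding closedin_closed by blast
  have "C \<inter> slice s = slice s \<inter> D" unfolding D(2) slice_def by blast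
  then show ?thesis using compact_Int_closed[OF compact_slice D(1)] by simp
qed

lemma continuous_on_component_slice: "continuous_on C (\<lambda>x. \<phi> x (s - \<tau> x))"
  using continuous_on_subset[OF continuous_\<tau> component_sub]
  by (intro continuous_on_flow continuous_intros)

lemma connected_component_slice: "connected (C \<inter> slice s)"
proof -
  have "C \<inter> slice s = (\<lambda>x. \<phi> x (s - \<tau> x)) ` C"
  proof
    show "C \<inter> slice s \<subseteq> (\<lambda>x. \<phi> x (s - \<tau> x)) ` C"
    proof
      fix x assume "x \<in> C \<inter> slice s"
      then have "x = \<phi> x (s - \<tau> x)" "x \<in> C" unfolding slice_def by auto
      then show "x \<in> (\<lambda>x. \<phi> x (s - \<tau> x)) ` C" by (rule image_eqI)
    qed
  qed (use component_slice in blast)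
  then show ?thesis
    using connected_continuous_image[OF continuous_on_component_slice in_components_connected[OF C]]
    by simp
qed

lemma component_slice_nonempty: "C \<inter> slice s \<noteq> {}"
  using component_slice in_components_nonempty[OF C] by blast

text \<open>\<open>H - K\<close> and \<open>A - H\<close> are disjoint open sets covering
  \<open>A - K\<close>, so a connected set lies in one of them.\<close>

lemma component_homoclinic: "C \<subseteq> H \<or> C \<inter> H = {}"
proof -
  have "(H - K) \<inter> C = {} \<or> (A - H) \<inter> C = {}"
  proof (rule connectedD[OF in_components_connected[OF C] open_H_diff_K open_A_diff_H])
    show "C \<subseteq> (H - K) \<union> (A - H)" using component_sub by blast
  qed blast
  then show ?thesis using component_sub by blast
qed

lemma topological_section_component_slice: "topological_section \<phi> C (C \<inter> slice s)"
  unfolding topological_section_def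
proof (intro conjI ballI exI)
  show "flow_invariant \<phi> C" unfolding flow_invariant_def by auto
  show "compact (C \<inter> slice s)" by (rule compact_component_slice)
  show "\<exists>!y. y \<in> range (\<phi> x) \<inter> (C \<inter> slice s)" if x: "x \<in> C" for x
  proof (rule ex1I[of _ "\<phi> x (s - \<tau> x)"])
    show "\<phi> x (s - \<tau> x) \<in> range (\<phi> x) \<inter> (C \<inter> slice s)" using component_slice[OF x] by blast
    show "y = \<phi> x (s - \<tau> x)" if "y \<in> range (\<phi> x) \<inter> (C \<inter> slice s)" for y
      using that x component_sub unfolding slice_def by auto
  qed
  \<comment> \<open>The inverse records the point where the orbit crosses level \<open>s\<close> and
    the time elapsed since then.\<close>
  show "homeomorphism ((C \<inter> slice s) \<times> UNIV) C (\<lambda>(x, t). \<phi> x t) (\<lambda>x. (\<phi> x (s - \<tau> x), \<tau> x - s))"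
  proof (rule homeomorphismI)
    show "continuous_on ((C \<inter> slice s) \<times> UNIV) (\<lambda>(x, t). \<phi> x t)"
      unfolding case_prod_beta
      by (intro continuous_on_flow continuous_on_fst continuous_on_snd continuous_on_id)
    show "continuous_on C (\<lambda>x. (\<phi> x (s - \<tau> x), \<tau> x - s))"
      using continuous_on_subset[OF continuous_\<tau> component_sub]
      by (intro continuous_on_Pair continuous_on_component_slice continuous_intros)
    show "(\<lambda>(x, t). \<phi> x t) ` ((C \<inter> slice s) \<times> UNIV) \<subseteq> C" by auto
    show "(\<lambda>x. (\<phi> x (s - \<tau> x), \<tau> x - s)) ` C \<subseteq> (C \<inter> slice s) \<times> UNIV"
      using component_slice by blast
    show "(\<phi> (case z of (x, t) \<Rightarrow> \<phi> x t) (s - \<tau> (case z of (x, t) \<Rightarrow> \<phi> x t)),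
        \<tau> (case z of (x, t) \<Rightarrow> \<phi> x t) - s) = z" if "z \<in> (C \<inter> slice s) \<times> UNIV" for z
      using that by (auto simp: slice_def)
    show "(case (\<phi> y (s - \<tau> y), \<tau> y - s) of (x, t) \<Rightarrow> \<phi> x t) = y" if "y \<in> C" for y
      by simp
  qed
qed blast

end

text \<open>Each piece is connected, closed by compactness, and relatively open because components
  of \<open>A - K\<close> are open and the sign of \<tau> separates the two levels.\<close>

lemma components_frontier_block:
  assumes "locally connected (UNIV :: 'a set)" and "closed (block T)" and "T > 0"
  shows "components (frontier (block T)) =
    (\<lambda>C. C \<inter> slice (- T)) ` {C \<in> components (A - K). C \<subseteq> H} \<union>
    (\<lambda>C. C \<inter> slice T) ` components (A - K)" (is "_ = ?\<F>")
proof (rule components_eqI)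
  have open_comp: "open C" if "C \<in> components (A - K)" for C
    using assms(1) that open_A_diff_K unfolding locally_connected_open_component by force
  have Union: "\<Union> (components (A - K)) = A - K" by (rule Union_components)
  show union: "\<Union> ?\<F> = frontier (block T)"
  proof
    show "\<Union> ?\<F> \<subseteq> frontier (block T)" unfolding frontier_block[OF assms(2,3)] by blast
    show "frontier (block T) \<subseteq> \<Union> ?\<F>"
    proof
      fix x assume "x \<in> frontier (block T)"
      then have x: "x \<in> slice T \<or> x \<in> slice (- T) \<inter> H" unfolding frontier_block[OF assms(2,3)] by blast
      then have "x \<in> A - K" unfolding slice_def by blast
      then obtain C where C: "C \<in> components (A - K)" "x \<in> C" using Union by blast
      then show "x \<in> \<Union> ?\<F>" using x component_homoclinic[OF C(1)] by blast
    qed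
  qed
  \<comment> \<open>\<open>B\<close> is an open set isolating level \<open>s\<close> within the
    frontier; both levels are treated at once.\<close>
  have C_slice: "connected D \<and> D \<noteq> {} \<and> openin (top_of_set (frontier (block T))) D \<and>
      closedin (top_of_set (frontier (block T))) D"
    if C: "C \<in> components (A - K)" and D: "D = C \<inter> slice s" "D \<subseteq> frontier (block T)"
      and B: "open B" "frontier (block T) \<inter> B = slice s \<inter> frontier (block T)" for C D s B
  proof (intro conjI)
    show "connected D" "D \<noteq> {}"
      unfolding D(1) by (rule connected_component_slice[OF C] component_slice_nonempty[OF C])+
    have "D = frontier (block T) \<inter> (C \<inter> B)" using B D by blast
    then show "openin (top_of_set (frontier (block T))) D"
      using B(1) open_comp[OF C] by (metis open_Int openin_open)
    show "closedin (top_of_set (frontier (block T))) D"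
      using compact_component_slice[OF C, of s] D compact_imp_closed closed_subset by blast
  qed
  show "connected D \<and> D \<noteq> {} \<and> openin (top_of_set (frontier (block T))) D \<and>
      closedin (top_of_set (frontier (block T))) D" if D: "D \<in> ?\<F>" for D
  proof -
    have sub: "D \<subseteq> frontier (block T)" using D union by blast
    from D consider C where "C \<in> components (A - K)" "D = C \<inter> slice T" |
      C where "C \<in> components (A - K)" "D = C \<inter> slice (- T)" by blast
    then show ?thesis
    proof cases
      case 1
      have "frontier (block T) \<inter> {x \<in> A - K. 0 < \<tau> x} = slice T \<inter> frontier (block T)"
        using \<open>T > 0\<close> unfolding frontier_block[OF assms(2,3)] slice_def by auto
      then show ?thesis by (rule C_slice[OF 1 sub open_greater])
    next
      case 2
      have "frontier (block T) \<inter> {x \<in> A - K. \<tau> x < 0} = slice (- T) \<inter> frontier (block T)"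
        using \<open>T > 0\<close> unfolding frontier_block[OF assms(2,3)] slice_def by auto
      then show ?thesis by (rule C_slice[OF 2 sub open_less])
    qed
  qed
qed

lemma finite_components:
  assumes "locally connected (UNIV :: 'a set)"
  shows "finite (components (A - K))"
proof -
  obtain N where N: "compact N" "K \<subseteq> interior N" "N \<subseteq> A" "isolating_neighbourhood \<phi> K N"
    by (rule isolating_neighbourhood_within[OF open_UNIV subset_UNIV])
  have "open C" if "C \<in> components (A - K)" for C
    using assms that open_A_diff_K unfolding locally_connected_open_component by force
  moreover have "frontier N \<subseteq> \<Union> (components (A - K))"
    using frontier_neighbourhood(2)[OF N(1-3)] Union_components[of "A - K"] by simp
  ultimately obtain \<D> where \<D>: "\<D> \<subseteq> components (A - K)" "finite \<D>" "frontier N \<subseteq> \<Union> \<D>"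
    using compactE[OF frontier_neighbourhood(1)[OF N(1-3)]] by metis
  \<comment> \<open>A component is invariant and its orbits cross the frontier, so it meets, hence
    equals, a member of the subcover.\<close>
  have "C \<in> \<D>" if C: "C \<in> components (A - K)" for C
  proof -
    obtain x where x: "x \<in> C" using in_components_nonempty[OF C] by blast
    then have xA: "x \<in> A - K" using component_sub[OF C] by blast
    obtain t where "\<phi> x t \<in> frontier N" by (rule orbit_meets_frontier[OF N(4) xA])
    then obtain D where D: "D \<in> \<D>" "\<phi> x t \<in> D" using \<D>(3) by blast
    then have "D \<inter> C \<noteq> {}" using x flow_mem_component[OF C, of x t] by blast
    then show ?thesis using components_nonoverlap[OF C, of D] D \<D>(1) by blast
  qed
  then show ?thesis using finite_subset[OF _ \<D>(2)] by blast
qed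

lemma mem_component_iff_homoclinic:
  assumes "C \<in> components (A - K)" "x \<in> C" shows "x \<in> H \<longleftrightarrow> C \<subseteq> H"
  using component_homoclinic[OF assms(1)] assms(2) by blast

lemma H_eq: "H = K \<union> \<Union> {C \<in> components (A - K). C \<subseteq> H}"
proof
  show "H \<subseteq> K \<union> \<Union> {C \<in> components (A - K). C \<subseteq> H}"
  proof
    fix x assume x: "x \<in> H"
    show "x \<in> K \<union> \<Union> {C \<in> components (A - K). C \<subseteq> H}"
    proof (cases "x \<in> K")
      case False
      then have "x \<in> \<Union> (components (A - K))"
        using x H_sub_A unfolding Union_components by blast
      then obtain C where "C \<in> components (A - K)" "x \<in> C" by blast
      then show ?thesis using x mem_component_iff_homoclinic[of C x] by blast
    qed blast
  qed
  show "K \<union> \<Union> {C \<in> components (A - K). C \<subseteq> H} \<subseteq> H" using K_sub_H by blast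
qed

lemma A_eq: "A = H \<union> \<Union> {C \<in> components (A - K). \<not> C \<subseteq> H}"
proof
  show "A \<subseteq> H \<union> \<Union> {C \<in> components (A - K). \<not> C \<subseteq> H}"
  proof
    fix x assume x: "x \<in> A"
    show "x \<in> H \<union> \<Union> {C \<in> components (A - K). \<not> C \<subseteq> H}"
    proof (cases "x \<in> K")
      case False
      then have "x \<in> \<Union> (components (A - K))"
        using x unfolding Union_components by blast
      then obtain C where "C \<in> components (A - K)" "x \<in> C" by blast
      then show ?thesis using mem_component_iff_homoclinic[of C x] by blast
    qed (use K_sub_H in blast)
  qed
  show "H \<union> \<Union> {C \<in> components (A - K). \<not> C \<subseteq> H} \<subseteq> A"
    using H_sub_A component_sub by blast
qed

lemma isolating_block_basis:
  assumes "K \<subseteq> interior U"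
  obtains T where "T > 0" "block T \<subseteq> U" "isolating_neighbourhood \<phi> K (block T)"
proof -
  obtain N where N: "compact N" "K \<subseteq> interior N" "N \<subseteq> interior U" "N \<subseteq> A"
    "isolating_neighbourhood \<phi> K N"
    by (rule isolating_neighbourhood_within[OF open_interior assms])
  obtain T where T: "T > 0" "block T \<subseteq> interior N"
    using block_within[OF open_interior N(2)] by (metis order_refl)
  have sub: "block T \<subseteq> N" using T(2) interior_subset[of N] by blast
  show ?thesis
  proof (rule that[OF T(1)])
    show "block T \<subseteq> U" using sub N(3) interior_subset[of U] by blast
    show "isolating_neighbourhood \<phi> K (block T)"
      by (rule isolating_neighbourhood_subset[OF N(5) compact_block[OF N(1) sub N(4)]
            K_sub_interior_block sub])
  qed
qed

lemma inj_on_component_slice: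
  assumes "inj_on C I" "C ` I \<subseteq> components (A - K)"
  shows "inj_on (\<lambda>j. C j \<inter> slice s) I"
proof (rule inj_onI)
  fix i j assume ij: "i \<in> I" "j \<in> I" "C i \<inter> slice s = C j \<inter> slice s"
  have comp: "C i \<in> components (A - K)" "C j \<in> components (A - K)" using assms(2) ij by blast+
  have "C i \<inter> C j \<noteq> {}" using component_slice_nonempty[OF comp(1), of s] ij(3) by blast
  then have "C i = C j" using components_nonoverlap[OF comp] by blast
  then show "i = j" using inj_onD[OF assms(1) _ ij(1,2)] by blast
qed

end

section \<open>Enumeration of the components\<close>

text \<open>Two bijections are pasted so that members satisfying \<open>P\<close> come first; this
  gives the homoclinic components the indices \<open>1\<close> to \<open>r\<close>.\<close>

lemma ex_enumeration_of_partition: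
  assumes "finite \<C>"
  obtains C :: "nat \<Rightarrow> 'b" and r s where "r \<le> s" "bij_betw C {1..s} \<C>"
    "C ` {1..r} = {c \<in> \<C>. P c}" "C ` {r+1..s} = {c \<in> \<C>. \<not> P c}"
proof -
  define r where "r = card {c \<in> \<C>. P c}"
  define q where "q = card {c \<in> \<C>. \<not> P c}"
  obtain f where f: "bij_betw f {1..r} {c \<in> \<C>. P c}"
    using ex_bij_betw_nat_finite_1[of "{c \<in> \<C>. P c}"] assms unfolding r_def by auto
  have "card {r+1..r+q} = card {c \<in> \<C>. \<not> P c}" unfolding q_def by simp
  then obtain g where g: "bij_betw g {r+1..r+q} {c \<in> \<C>. \<not> P c}"
    using finite_same_card_bij[of "{r+1..r+q}" "{c \<in> \<C>. \<not> P c}"] assms by auto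
  define C where "C j = (if j \<le> r then f j else g j)" for j
  have C1: "bij_betw C {1..r} {c \<in> \<C>. P c}"
    using f by (subst bij_betw_cong[of _ _ f]) (auto simp: C_def)
  have C2: "bij_betw C {r+1..r+q} {c \<in> \<C>. \<not> P c}"
    using g by (subst bij_betw_cong[of _ _ g]) (auto simp: C_def)
  have "bij_betw C ({1..r} \<union> {r+1..r+q}) ({c \<in> \<C>. P c} \<union> {c \<in> \<C>. \<not> P c})"
    by (rule bij_betw_combine[OF C1 C2]) blast
  moreover have "{1..r} \<union> {r+1..r+q} = {1..r+q}" by auto
  moreover have "{c \<in> \<C>. P c} \<union> {c \<in> \<C>. \<not> P c} = \<C>" by blast
  ultimately have "bij_betw C {1..r+q} \<C>" by simp
  then show ?thesis
    using that[of r "r + q" C] C1 C2 by (simp add: bij_betw_def)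
qed

section \<open>Decomposition of the basin and the basis of blocks\<close>

theorem lemma6:
  fixes \<phi> :: "'a::metric_space \<Rightarrow> real \<Rightarrow> 'a" and K :: "'a set"
  assumes "locally compact (UNIV :: 'a set)"
    and "locally connected (UNIV :: 'a set)"
    and "continuous_flow \<phi>"
    and "isolated_attractor \<phi> K"
    and "only_internal_explosions \<phi> K"
  shows "\<exists>(s::nat) (r::nat) (C :: nat \<Rightarrow> 'a set).
    bij_betw C {1..s} (components (basin \<phi> K - K)) \<and> r \<le> s \<and>
    stabilization \<phi> K = homoclinic_points \<phi> K \<and>
    homoclinic_points \<phi> K = K \<union> (\<Union>j\<in>{1..r}. C j) \<and>
    basin \<phi> K = stabilization \<phi> K \<union> (\<Union>j\<in>{r+1..s}. C j) \<and>
    (\<exists>\<N>. neighbourhood_basis K \<N> \<and>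
      (\<forall>N\<in>\<N>. isolating_neighbourhood \<phi> K N \<and>
        (\<exists>(nm :: nat \<Rightarrow> 'a set) (np :: nat \<Rightarrow> 'a set).
          inj_on nm {1..r} \<and> inj_on np {1..s} \<and> nm ` {1..r} \<inter> np ` {1..s} = {} \<and>
          components (frontier N) = nm ` {1..r} \<union> np ` {1..s} \<and>
          (\<forall>j\<in>{1..r}. nm j \<subseteq> negative_part \<phi> N) \<and>
          (\<forall>j\<in>{1..s}. np j \<subseteq> positive_part \<phi> N) \<and>
          (\<forall>j\<in>{1..r}. topological_section \<phi> (C j) (nm j) \<and> topological_section \<phi> (C j) (np j)) \<and>
          (\<forall>j\<in>{r+1..s}. topological_section \<phi> (C j) (np j)))))"
proof -
  interpret attractor \<phi> K
    using assms by unfold_locales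
  obtain \<tau> where \<tau>: "continuous_on (A - K) \<tau>"
    "\<And>x t. x \<in> A - K \<Longrightarrow> \<tau> (\<phi> x t) = \<tau> x + t" "compact {x \<in> A - K. \<tau> x = 0}"
    using section_function by blast
  interpret attractor_section \<phi> K \<tau>
    using \<tau> by unfold_locales auto
  obtain C :: "nat \<Rightarrow> 'a set" and r s where rs: "r \<le> s"
    and bij: "bij_betw C {1..s} (components (A - K))"
    and Cr: "C ` {1..r} = {c \<in> components (A - K). c \<subseteq> H}"
    and Cs: "C ` {r+1..s} = {c \<in> components (A - K). \<not> c \<subseteq> H}"
    by (rule ex_enumeration_of_partition[OF finite_components[OF assms(2)]])
  have comp: "C j \<in> components (A - K)" if "j \<in> {1..s}" for j
    using bij_betwE[OF bij] that by blast
  have hom: "C j \<subseteq> H" if "j \<in> {1..r}" for j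
    using Cr that by blast
  have img: "C ` {1..s} = components (A - K)" using bij by (rule bij_betw_imp_surj_on)
  have inj: "inj_on C {1..s}" using bij by (rule bij_betw_imp_inj_on)
  define \<N> where "\<N> = {block T |T. T > 0 \<and> isolating_neighbourhood \<phi> K (block T)}"
  have basis: "neighbourhood_basis K \<N>"
    unfolding neighbourhood_basis_def
  proof (intro conjI ballI allI impI)
    show "K \<subseteq> interior N" if "N \<in> \<N>" for N
      using that K_sub_interior_block unfolding \<N>_def by blast
    show "\<exists>N\<in>\<N>. N \<subseteq> U" if U: "K \<subseteq> interior U" for U
    proof -
      obtain T where "T > 0" "block T \<subseteq> U" "isolating_neighbourhood \<phi> K (block T)"
        by (rule isolating_block_basis[OF U])
      then show ?thesis unfolding \<N>_def by blast
    qed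
  qed
  have blocks: "isolating_neighbourhood \<phi> K N \<and>
        (\<exists>(nm :: nat \<Rightarrow> 'a set) (np :: nat \<Rightarrow> 'a set).
          inj_on nm {1..r} \<and> inj_on np {1..s} \<and> nm ` {1..r} \<inter> np ` {1..s} = {} \<and>
          components (frontier N) = nm ` {1..r} \<union> np ` {1..s} \<and>
          (\<forall>j\<in>{1..r}. nm j \<subseteq> negative_part \<phi> N) \<and>
          (\<forall>j\<in>{1..s}. np j \<subseteq> positive_part \<phi> N) \<and>
          (\<forall>j\<in>{1..r}. topological_section \<phi> (C j) (nm j) \<and> topological_section \<phi> (C j) (np j)) \<and>
          (\<forall>j\<in>{r+1..s}. topological_section \<phi> (C j) (np j)))" if N_mem: "N \<in> \<N>" for N
  proof -
    obtain T where N: "N = block T" "T > 0" "isolating_neighbourhood \<phi> K N"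
      using N_mem unfolding \<N>_def by blast
    have closed: "closed (block T)"
      using isolating_neighbourhoodD(1)[OF N(3)] unfolding N(1) by (rule compact_imp_closed)
    \<comment> \<open>Level \<open>- T\<close> is the exit from \<open>K\<close> along homoclinic
      orbits, level \<open>T\<close> the entrance shared by all components.\<close>
    define nm where "nm j = C j \<inter> slice (- T)" for j
    define np where "np j = C j \<inter> slice T" for j
    have "inj_on nm {1..r}" unfolding nm_def
      using rs img by (intro inj_on_component_slice inj_on_subset[OF inj]) auto
    moreover have "inj_on np {1..s}" unfolding np_def
      using img by (intro inj_on_component_slice inj) simp
    moreover have "nm ` {1..r} \<inter> np ` {1..s} = {}"
    proof -
      have "nm i \<noteq> np j" if "i \<in> {1..r}" "j \<in> {1..s}" for i j
      proof -
        \<comment> \<open>Disjoint slices give distinct pieces only because the pieces are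
          nonempty.\<close>
        have "np j \<noteq> {}" unfolding np_def by (rule component_slice_nonempty[OF comp[OF that(2)]])
        moreover have "slice T \<inter> slice (- T) = {}" using N(2) unfolding slice_def by auto
        ultimately show ?thesis unfolding nm_def np_def by blast
      qed
      then show ?thesis by blast
    qed
    moreover have "components (frontier N) = nm ` {1..r} \<union> np ` {1..s}"
    proof -
      have "nm ` {1..r} = (\<lambda>C. C \<inter> slice (- T)) ` C ` {1..r}"
        "np ` {1..s} = (\<lambda>C. C \<inter> slice T) ` C ` {1..s}"
        unfolding nm_def np_def image_image by blast+
      then show ?thesis
        unfolding N(1) components_frontier_block[OF assms(2) closed N(2)] img Cr by simp
    qed
    moreover have "\<forall>j\<in>{1..r}. nm j \<subseteq> negative_part \<phi> N"
    proof (intro ballI subsetI)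
      fix j x assume "j \<in> {1..r}" "x \<in> nm j"
      then have "x \<in> slice (- T) \<inter> H" unfolding nm_def using hom by blast
      then show "x \<in> negative_part \<phi> N"
        using flow_block_backward[of x T] flow_block_backward[of x T 0]
        unfolding negative_part_def N(1) by auto
    qed
    moreover have "\<forall>j\<in>{1..s}. np j \<subseteq> positive_part \<phi> N"
    proof (intro ballI subsetI)
      fix j x assume "j \<in> {1..s}" "x \<in> np j"
      then have "x \<in> slice T" unfolding np_def by blast
      then show "x \<in> positive_part \<phi> N"
        using flow_block_forward[of x T] flow_block_forward[of x T 0]
        unfolding positive_part_def N(1) by auto
    qed
    moreover have "topological_section \<phi> (C j) (nm j)" "topological_section \<phi> (C j) (np j)"
      if "j \<in> {1..s}" for j
      unfolding nm_def np_def by (rule topological_section_component_slice[OF comp[OF that]])+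
    then have "\<forall>j\<in>{1..r}. topological_section \<phi> (C j) (nm j) \<and> topological_section \<phi> (C j) (np j)"
      "\<forall>j\<in>{r+1..s}. topological_section \<phi> (C j) (np j)" using rs by simp_all
    ultimately show ?thesis using N(3) by blast
  qed
  have H_eq': "H = K \<union> (\<Union>j\<in>{1..r}. C j)" using H_eq unfolding Cr by simp
  have A_eq': "A = stabilization \<phi> K \<union> (\<Union>j\<in>{r+1..s}. C j)"
    using A_eq unfolding stabilization_eq Cs by simp
  show ?thesis
    by (intro exI[of _ s] exI[of _ r] exI[of _ C] exI[of _ \<N>] conjI ballI blocks)
      (fact bij rs stabilization_eq H_eq' A_eq' basis)+
qed

end
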